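(* Let $k\ge 2$, let $F=F(a_1,\dots,a_k)$ be the free group with fixed free basis $\{a_1,\dots,a_k\}$, and let $\phi\in \mathrm{Out}(F)$. Put $$\lambda_0(\phi)=\inf_{w}\ \max\left\{\frac{\|\phi(w)\|}{\|w\|},\frac{\|\phi^{-1}(w)\|}{\|w\|}\right\},$$ the infimum being over all nontrivial cyclic words (equivalently, nontrivial conjugacy classes) $w$ of $F$. Then $\lambda_0(\phi)$ is a rational number, algorithmically computable in terms of $\phi$. The outer automorphism $\phi$ is strictly hyperbolic if and only if $\lambda_0(\phi)>1$, and hence it is algorithmically decidable whether $\phi$ is strictly hyperbolic.
   Context: A cyclic word is an equivalence class of cyclically reduced words in $\{a_1,\dots,a_k\}^{\pm1}$ up to cyclic permutation; nontrivial cyclic words correspond bijectively to nontrivial conjugacy classes of $F$, and $\mathrm{Out}(F)$ acts on them. For a cyclic word $w$, $\|w\|$ is the length of any cyclically reduced word representing it. An outer automorphism $\phi$ is strictly hyperbolic if there is $\lambda>1$ such that $\lambda\|w\|\le\max\{\|\phi(w)\|,\|\phi^{-1}(w)\|\}$ for every cyclic word $w$. Algorithms take as input a representative automorphism of $\phi$, e.g. given by the images of $a_1,\dots,a_k$ (or by an expression of $\phi$ as a product of generators of $\mathrm{Out}(F)$). *)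

theory Defs
  imports Complex_Main "HOL-Algebra.Coset" "HOL-Algebra.Bij" "HOL-Library.Nat_Bijection"
begin

section \<open>Free groups of finite rank\<close>

text \<open>The letter \<open>(i, True)\<close> is the \<open>i\<close>-th basis element (indices start at 0) and
  \<open>(i, False)\<close> is its inverse.  The free group of rank \<open>k\<close> consists of the reduced words,
  multiplied by concatenation followed by free reduction.\<close>

type_synonym letter = "nat \<times> bool"
type_synonym word = "letter list"

definition inv_letter :: "letter \<Rightarrow> letter" where
  "inv_letter x = (fst x, \<not> snd x)"

definition words :: "nat \<Rightarrow> word set" where
  "words k = {w. \<forall>x\<in>set w. fst x < k}"

definition reduced :: "word \<Rightarrow> bool" where
  "reduced w \<longleftrightarrow> (\<forall>i. Suc i < length w \<longrightarrow> w ! Suc i \<noteq> inv_letter (w ! i))"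

fun push :: "letter \<Rightarrow> word \<Rightarrow> word" where
  "push x [] = [x]"
| "push x (y # w) = (if y = inv_letter x then w else x # y # w)"

definition free_reduce :: "word \<Rightarrow> word" where
  "free_reduce w = foldr push w []"

definition free_group :: "nat \<Rightarrow> word monoid" where
  "free_group k =
    \<lparr>carrier = {w \<in> words k. reduced w}, mult = (\<lambda>u v. free_reduce (u @ v)), one = []\<rparr>"

lemma inv_letter_invol [simp]: "inv_letter (inv_letter x) = x"
  by (simp add: inv_letter_def)

lemma inv_letter_neq [simp]: "inv_letter x \<noteq> x" "x \<noteq> inv_letter x"
  by (auto simp: inv_letter_def prod_eq_iff)

lemma fst_inv_letter [simp]: "fst (inv_letter x) = fst x"
  by (simp add: inv_letter_def)

lemma reduced_Nil [simp]: "reduced []"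
  by (simp add: reduced_def)

lemma reduced_single [simp]: "reduced [x]"
  by (simp add: reduced_def)

lemma reduced_Cons_Cons [simp]:
  "reduced (x # y # w) \<longleftrightarrow> y \<noteq> inv_letter x \<and> reduced (y # w)"
  unfolding reduced_def
  by (auto simp: nth_Cons split: nat.splits)

lemma reduced_ConsD: "reduced (x # w) \<Longrightarrow> reduced w"
  by (cases w) auto

lemma push_reduced: "reduced w \<Longrightarrow> reduced (push x w)"
  by (cases w) (auto dest: reduced_ConsD)

lemma push_cancel: "reduced w \<Longrightarrow> push x (push (inv_letter x) w) = w"
  by (cases w rule: list.exhaust; cases "tl w") auto

lemma push_words: "w \<in> words k \<Longrightarrow> fst x < k \<Longrightarrow> push x w \<in> words k"
  by (cases w) (auto simp: words_def)

lemma foldr_push_reduced: "reduced w \<Longrightarrow> reduced (foldr push u w)"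
  by (induction u) (auto intro: push_reduced)

lemma foldr_push_words: "u \<in> words k \<Longrightarrow> w \<in> words k \<Longrightarrow> foldr push u w \<in> words k"
proof (induction u)
  case (Cons x u)
  have "fst x < k" "u \<in> words k" using Cons.prems(1) by (simp_all add: words_def)
  with Cons show ?case by (simp add: push_words)
qed simp

lemma foldr_push_id: "reduced w \<Longrightarrow> foldr push w [] = w"
proof (induction w)
  case (Cons x w)
  then show ?case by (cases w) simp_all
qed simp

lemma foldr_push_push: "reduced w \<Longrightarrow> foldr push (push x u) w = push x (foldr push u w)"
  by (cases u) (simp_all add: push_cancel foldr_push_reduced)

lemma foldr_push_foldr: "reduced w \<Longrightarrow> foldr push (foldr push u v) w = foldr push u (foldr push v w)"
  by (induction u) (simp_all add: foldr_push_push)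

lemma foldr_push_inv: "reduced w \<Longrightarrow> foldr push (rev (map inv_letter u)) (foldr push u w) = w"
proof (induction u arbitrary: w)
  case (Cons x u)
  have "push (inv_letter x) (push (inv_letter (inv_letter x)) (foldr push u w)) = foldr push u w"
    by (rule push_cancel) (simp add: Cons.prems foldr_push_reduced)
  with Cons show ?case by simp
qed simp

lemma carrier_free_group: "u \<in> carrier (free_group k) \<longleftrightarrow> u \<in> words k \<and> reduced u"
  by (simp add: free_group_def)

lemma one_free_group: "\<one>\<^bsub>free_group k\<^esub> = []"
  by (simp add: free_group_def)

lemma mult_free_group: "reduced v \<Longrightarrow> u \<otimes>\<^bsub>free_group k\<^esub> v = foldr push u v"
  by (simp add: free_group_def free_reduce_def foldr_push_id)

lemma words_Nil [simp]: "[] \<in> words k"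
  by (simp add: words_def)

lemma group_free_group: "group (free_group k)"
proof (rule groupI)
  fix u assume "u \<in> carrier (free_group k)"
  then have u: "u \<in> words k" "reduced u" by (simp_all add: carrier_free_group)
  define v where "v = foldr push (rev (map inv_letter u)) []"
  have "rev (map inv_letter u) \<in> words k" using u by (auto simp: words_def)
  then have "v \<in> words k" unfolding v_def by (rule foldr_push_words) simp
  moreover have "reduced v" unfolding v_def by (rule foldr_push_reduced) simp
  ultimately have "v \<in> carrier (free_group k)" by (simp add: carrier_free_group)
  moreover have "v \<otimes>\<^bsub>free_group k\<^esub> u = \<one>\<^bsub>free_group k\<^esub>"
    using foldr_push_foldr[OF u(2), of "rev (map inv_letter u)" "[]"]
      foldr_push_inv[OF reduced_Nil, of u]
    by (simp only: v_def mult_free_group[OF u(2)] one_free_group foldr_push_id[OF u(2)] foldr.simps id_apply)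
  ultimately show "\<exists>v\<in>carrier (free_group k). v \<otimes>\<^bsub>free_group k\<^esub> u = \<one>\<^bsub>free_group k\<^esub>" ..
qed (simp_all only: carrier_free_group mult_free_group one_free_group words_Nil reduced_Nil
      foldr_push_words foldr_push_reduced foldr_push_foldr foldr.simps id_apply)


section \<open>Outer automorphisms\<close>

definition inner_auts :: "('a, 'b) monoid_scheme \<Rightarrow> ('a \<Rightarrow> 'a) set" where
  "inner_auts G = (\<lambda>g. \<lambda>x\<in>carrier G. g \<otimes>\<^bsub>G\<^esub> x \<otimes>\<^bsub>G\<^esub> inv\<^bsub>G\<^esub> g) ` carrier G"

lemma (in group) normal_inner_auts: "inner_auts G \<lhd> AutoGroup G"
proof -
  let ?c = "\<lambda>g. \<lambda>x\<in>carrier G. g \<otimes> x \<otimes> inv g"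
  have hom: "?c g \<in> hom G G" if "g \<in> carrier G" for g
    using that by (auto simp: hom_def m_assoc inv_solve_left)
  have comp: "compose (carrier G) (?c g) (?c h) = ?c (g \<otimes> h)"
    if "g \<in> carrier G" "h \<in> carrier G" for g h
    using that by (auto simp: compose_def m_assoc inv_mult_group fun_eq_iff)
  have inv: "?c (inv g) (?c g x) = x" "?c g (?c (inv g) x) = x"
    if "g \<in> carrier G" "x \<in> carrier G" for g x
    using that by (auto simp: m_assoc simp flip: m_assoc[of g "inv g"] m_assoc[of "inv g" g])
  have bij: "?c g \<in> Bij (carrier G)" if g: "g \<in> carrier G" for g
  proof -
    have "bij_betw (?c g) (carrier G) (carrier G)"
      by (rule bij_betw_byWitness[where f' = "?c (inv g)"]) (use g inv[OF g] in auto)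
    then show ?thesis by (auto simp: Bij_def)
  qed
  have auto: "?c g \<in> auto G" if "g \<in> carrier G" for g
    using hom bij that by (simp add: auto_def)
  interpret A: group "AutoGroup G" by (rule AutoGroup)
  have A_simps: "carrier (AutoGroup G) = auto G" "\<one>\<^bsub>AutoGroup G\<^esub> = (\<lambda>x\<in>carrier G. x)"
    "\<And>a b. a \<in> auto G \<Longrightarrow> b \<in> auto G \<Longrightarrow> a \<otimes>\<^bsub>AutoGroup G\<^esub> b = compose (carrier G) a b"
    by (auto simp: AutoGroup_def BijGroup_def auto_def)
  have one: "?c \<one> = \<one>\<^bsub>AutoGroup G\<^esub>"
    by (auto simp: A_simps fun_eq_iff)
  have sub: "subgroup (inner_auts G) (AutoGroup G)"
  proof (rule A.subgroupI)
    show "inner_auts G \<subseteq> carrier (AutoGroup G)"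
      using auto by (auto simp: inner_auts_def A_simps)
    show "inner_auts G \<noteq> {}" by (auto simp: inner_auts_def)
  next
    fix a assume "a \<in> inner_auts G"
    then obtain g where g: "g \<in> carrier G" "a = ?c g" by (auto simp: inner_auts_def)
    have "?c (inv g) \<otimes>\<^bsub>AutoGroup G\<^esub> a = \<one>\<^bsub>AutoGroup G\<^esub>"
      using g auto[of g] auto[of "inv g"] comp[of "inv g" g] one by (simp add: A_simps)
    then have eq: "inv\<^bsub>AutoGroup G\<^esub> a = ?c (inv g)"
      using g auto[of g] auto[of "inv g"] by (intro A.inv_equality) (auto simp: A_simps)
    show "inv\<^bsub>AutoGroup G\<^esub> a \<in> inner_auts G"
      unfolding eq inner_auts_def by (rule imageI) (simp add: g)
  next
    fix a b assume "a \<in> inner_auts G" "b \<in> inner_auts G"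
    then obtain g h where gh: "g \<in> carrier G" "a = ?c g" "h \<in> carrier G" "b = ?c h"
      by (auto simp: inner_auts_def)
    have "a \<otimes>\<^bsub>AutoGroup G\<^esub> b = ?c (g \<otimes> h)"
      using gh auto[of g] auto[of h] comp[of g h] by (simp add: A_simps)
    then show "a \<otimes>\<^bsub>AutoGroup G\<^esub> b \<in> inner_auts G" using gh by (auto simp: inner_auts_def)
  qed
  show ?thesis
    unfolding A.normal_inv_iff
  proof (intro conjI ballI sub)
    fix a b assume a: "a \<in> carrier (AutoGroup G)" and "b \<in> inner_auts G"
    then obtain g where g: "g \<in> carrier G" "b = ?c g" by (auto simp: inner_auts_def)
    have aG: "a \<in> auto G" using a by (simp add: A_simps)
    then have ah: "a \<in> hom G G" and aB: "a \<in> Bij (carrier G)" by (auto simp: auto_def)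
    then interpret a: group_hom G G a by unfold_locales
    have ag: "a g \<in> carrier G" using g by simp
    have "compose (carrier G) a (?c g) = compose (carrier G) (?c (a g)) a"
      using g by (auto simp: compose_def fun_eq_iff)
    then have "a \<otimes>\<^bsub>AutoGroup G\<^esub> b = ?c (a g) \<otimes>\<^bsub>AutoGroup G\<^esub> a"
      using aG auto[OF g(1)] auto[OF ag] by (simp add: g(2) A_simps)
    then have "a \<otimes>\<^bsub>AutoGroup G\<^esub> b \<otimes>\<^bsub>AutoGroup G\<^esub> inv\<^bsub>AutoGroup G\<^esub> a = ?c (a g)"
      using a auto[OF ag] A.inv_closed[OF a] by (simp add: A.m_assoc A_simps(1) del: restrict_apply)
    then show "a \<otimes>\<^bsub>AutoGroup G\<^esub> b \<otimes>\<^bsub>AutoGroup G\<^esub> inv\<^bsub>AutoGroup G\<^esub> a \<in> inner_auts G"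
      using ag by (auto simp: inner_auts_def)
  qed
qed

text \<open>The elements of \<open>Out k\<close> are cosets, so an outer automorphism is literally the set of
  the automorphisms representing it.\<close>

definition Out :: "nat \<Rightarrow> (word \<Rightarrow> word) set monoid" where
  "Out k = AutoGroup (free_group k) Mod inner_auts (free_group k)"

lemma group_Out: "group (Out k)"
  unfolding Out_def
  by (intro normal.factorgroup_is_group group.normal_inner_auts group_free_group)


section \<open>Cyclic words\<close>

definition cyc_reduced :: "word \<Rightarrow> bool" where
  "cyc_reduced w \<longleftrightarrow> reduced w \<and> (w \<noteq> [] \<longrightarrow> hd w \<noteq> inv_letter (last w))"

definition cyclic_words :: "nat \<Rightarrow> word set set" where
  "cyclic_words k = {{rotate n u | n. True} | u. u \<in> words k \<and> cyc_reduced u}"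

text \<open>The trivial cyclic word is the class \<open>{[]}\<close> of the empty word.\<close>

definition nontrivial_cyclic_words :: "nat \<Rightarrow> word set set" where
  "nontrivial_cyclic_words k = cyclic_words k - {{[]}}"

text \<open>All representatives of a cyclic word have the same length.\<close>

definition cyc_length :: "word set \<Rightarrow> nat" where
  "cyc_length C = (THE n. \<exists>u\<in>C. length u = n)"

text \<open>The cyclic word corresponding to the conjugacy class of a group element.\<close>

definition cyclic_word_of :: "nat \<Rightarrow> word \<Rightarrow> word set" where
  "cyclic_word_of k g =
    {u. cyc_reduced u \<and> (\<exists>h\<in>carrier (free_group k).
          u = h \<otimes>\<^bsub>free_group k\<^esub> g \<otimes>\<^bsub>free_group k\<^esub> inv\<^bsub>free_group k\<^esub> h)}"

text \<open>The action of \<open>Out k\<close> on cyclic words; the sets in the union all coincide, as the conjugacy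
  class of \<open>\<alpha> u\<close> depends neither on the representative \<open>\<alpha>\<close> of \<open>\<phi>\<close> nor on that of \<open>C\<close>.\<close>

definition out_act :: "nat \<Rightarrow> (word \<Rightarrow> word) set \<Rightarrow> word set \<Rightarrow> word set" where
  "out_act k \<phi> C = (\<Union>\<alpha>\<in>\<phi>. \<Union>u\<in>C. cyclic_word_of k (\<alpha> u))"

definition strictly_hyperbolic :: "nat \<Rightarrow> (word \<Rightarrow> word) set \<Rightarrow> bool" where
  "strictly_hyperbolic k \<phi> \<longleftrightarrow> (\<exists>c::real. c > 1 \<and> (\<forall>w\<in>cyclic_words k.
     c * real (cyc_length w) \<le>
       max (real (cyc_length (out_act k \<phi> w))) (real (cyc_length (out_act k (inv\<^bsub>Out k\<^esub> \<phi>) w)))))"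

definition lambda0 :: "nat \<Rightarrow> (word \<Rightarrow> word) set \<Rightarrow> real" where
  "lambda0 k \<phi> = (INF w\<in>nontrivial_cyclic_words k.
     max (real (cyc_length (out_act k \<phi> w)) / real (cyc_length w))
         (real (cyc_length (out_act k (inv\<^bsub>Out k\<^esub> \<phi>) w)) / real (cyc_length w)))"


section \<open>Partial recursive functions\<close>

datatype recf =
    Zero
  | Succ
  | Proj nat
  | Comp recf "recf list"
  | PrimRec recf recf
  | Mu recf

text \<open>\<open>reval f xs y\<close> means that the computation of \<open>f\<close> on the arguments \<open>xs\<close> terminates
  with the result \<open>y\<close>.\<close>

inductive reval :: "recf \<Rightarrow> nat list \<Rightarrow> nat \<Rightarrow> bool" where
  Zero: "reval Zero xs 0"
| Succ: "reval Succ (x # xs) (Suc x)"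
| Proj: "i < length xs \<Longrightarrow> reval (Proj i) xs (xs ! i)"
| Comp: "length ys = length gs \<Longrightarrow> (\<And>i. i < length gs \<Longrightarrow> reval (gs ! i) xs (ys ! i)) \<Longrightarrow>
         reval f ys z \<Longrightarrow> reval (Comp f gs) xs z"
| PrimRec_0: "reval f xs y \<Longrightarrow> reval (PrimRec f g) (0 # xs) y"
| PrimRec_Suc: "reval (PrimRec f g) (n # xs) r \<Longrightarrow> reval g (n # r # xs) y \<Longrightarrow>
         reval (PrimRec f g) (Suc n # xs) y"
| Mu: "reval f (n # xs) 0 \<Longrightarrow> (\<And>m. m < n \<Longrightarrow> \<exists>y. reval f (m # xs) (Suc y)) \<Longrightarrow>
         reval (Mu f) xs n"

inductive_cases reval_ZeroE: "reval Zero xs y"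
inductive_cases reval_SuccE: "reval Succ xs y"
inductive_cases reval_ProjE: "reval (Proj i) xs y"
inductive_cases reval_CompE: "reval (Comp f gs) xs y"
inductive_cases reval_PrimRec_0E: "reval (PrimRec f g) (0 # xs) y"
inductive_cases reval_PrimRec_SucE: "reval (PrimRec f g) (Suc n # xs) y"
inductive_cases reval_MuE: "reval (Mu f) xs y"

lemma reval_deterministic: "reval f xs y \<Longrightarrow> reval f xs z \<Longrightarrow> y = z"
proof (induction arbitrary: z rule: reval.induct)
  case (Comp ys gs xs f y)
  from Comp.prems obtain ys' where ys': "length ys' = length gs"
    "\<And>i. i < length gs \<Longrightarrow> reval (gs ! i) xs (ys' ! i)" "reval f ys' z"
    by (elim reval_CompE) blast
  have "ys = ys'"
    using Comp ys' by (intro nth_equalityI) auto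
  then show ?case using Comp ys' by blast
next
  case (Mu f n xs)
  from Mu.prems have z: "reval f (z # xs) 0" "\<And>m. m < z \<Longrightarrow> \<exists>y. reval f (m # xs) (Suc y)"
    by (auto elim: reval_MuE)
  have "\<not> z < n" using Mu.IH(2) z(1) by fastforce
  moreover have "\<not> n < z" using Mu.IH(1) z(2) by fastforce
  ultimately show ?case by simp
qed (blast elim: reval_ZeroE reval_SuccE reval_ProjE reval_PrimRec_0E reval_PrimRec_SucE)+


section \<open>Encoding of inputs and outputs\<close>

definition letter_encode :: "letter \<Rightarrow> nat" where
  "letter_encode x = prod_encode (fst x, of_bool (snd x))"

definition word_encode :: "word \<Rightarrow> nat" where
  "word_encode w = list_encode (map letter_encode w)"

text \<open>An automorphism is given to an algorithm as the list of the images of the basis elements.\<close>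

definition aut_encode :: "nat \<Rightarrow> (word \<Rightarrow> word) \<Rightarrow> nat" where
  "aut_encode k \<alpha> = list_encode (map (\<lambda>i. word_encode (\<alpha> [(i, True)])) [0..<k])"

text \<open>A rational number is output as the numerator and denominator of its reduced fraction.\<close>

definition rat_encode :: "rat \<Rightarrow> nat" where
  "rat_encode r = (case quotient_of r of (p, q) \<Rightarrow> prod_encode (int_encode p, int_encode q))"

end

theory Submission
  imports Defs
begin

text \<open>By bounded cancellation, if a long block of letters occurs at two places of a cyclic word, then
  cutting the word there into two cyclic words adds up not only lengths but also the lengths of the
  images under \<open>\<phi>\<close> and \<open>\<phi>\<inverse>\<close>.  By the pigeonhole principle every cyclic word is thus composed of
  cyclic words \<open>w\<close> of computably bounded length.  On the other hand, the ratios of a mixture of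
  \<open>w\<^sub>1\<close> and \<open>w\<^sub>2\<close> are approximated by long products of powers of \<open>w\<^sub>1\<close> and \<open>w\<^sub>2\<close>.  So \<open>\<lambda>\<^sub>0\<close> is the
  value of a finite minimax problem \<open>max\<^sub>t min\<^sub>w (t \<parallel>\<phi>(w)\<parallel> + (1 - t) \<parallel>\<phi>\<inverse>(w)\<parallel>) / \<parallel>w\<parallel>\<close> with rational data,
  which has a rational solution.  A primal and a dual solution, together with the inverse
  automorphism, form a certificate that a primitive recursive check verifies; an unbounded search
  finds it.\<close>

section \<open>Total recursive functions\<close>

text \<open>The maximum of the two ratios does not pass from pieces to the whole: one piece may
  shrink under \<phi> and grow under its inverse, another the other way round. So a short word need
  not attain the infimum, which may only be approached by long mixtures. For fixed weights, however,
  comparing a weighted sum of the two image lengths with the length is a linear condition, and it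
  survives gluing. This is why the weights belong to the certificate: with them a lower bound valid
  for all words is a finite check, and duality provides weights for which it meets the upper bound
  given by a mixture. Cyclic lengths are handled as growth rates of powers of group elements. No
  conjugacy representatives have to be chosen, and cyclic words as sets enter only in the final
  translation to \<open>lambda0\<close>.\<close>

lemma reval_Comp1:
  assumes "reval g xs y" "reval f [y] z"
  shows "reval (Comp f [g]) xs z"
  by (rule reval.Comp[where ys = "[y]"]) (use assms in auto)

lemma reval_Comp2:
  assumes "reval g xs y" "reval h xs y'" "reval f [y, y'] z"
  shows "reval (Comp f [g, h]) xs z"
  by (rule reval.Comp[where ys = "[y, y']"]) (use assms in \<open>auto simp: less_Suc_eq\<close>)

lemma reval_Proj0: "reval (Proj 0) (x # xs) x"
  using reval.Proj[of 0 "x # xs"] by simp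

lemma reval_Proj1: "reval (Proj 1) (x # y # xs) y"
  using reval.Proj[of 1 "x # y # xs"] by simp

lemma reval_Proj2: "reval (Proj 2) (x # y # z # xs) z"
  using reval.Proj[of 2 "x # y # z # xs"] by simp

definition total_rec :: "(nat \<Rightarrow> nat) \<Rightarrow> bool" where
  "total_rec F \<longleftrightarrow> (\<exists>e. \<forall>n. reval e [n] (F n))"

definition total_rec2 :: "(nat \<Rightarrow> nat \<Rightarrow> nat) \<Rightarrow> bool" where
  "total_rec2 F \<longleftrightarrow> (\<exists>e. \<forall>m n. reval e [m, n] (F m n))"

lemma total_rec_id: "total_rec (\<lambda>n. n)"
  unfolding total_rec_def using reval_Proj0 by blast

lemma total_rec_comp: "total_rec F \<Longrightarrow> total_rec G \<Longrightarrow> total_rec (\<lambda>n. F (G n))"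
  unfolding total_rec_def by (meson reval_Comp1)

lemma total_rec_Suc: "total_rec Suc"
  unfolding total_rec_def using reval.Succ by blast

lemma total_rec_const: "total_rec (\<lambda>n. c)"
proof (induction c)
  case 0
  show ?case unfolding total_rec_def using reval.Zero by blast
next
  case (Suc c)
  show ?case by (rule total_rec_comp[OF total_rec_Suc Suc])
qed

lemma total_rec_bin:
  "total_rec2 H \<Longrightarrow> total_rec F \<Longrightarrow> total_rec G \<Longrightarrow> total_rec (\<lambda>n. H (F n) (G n))"
  unfolding total_rec_def total_rec2_def by (meson reval_Comp2)

lemma total_rec2_comp: "total_rec F \<Longrightarrow> total_rec2 H \<Longrightarrow> total_rec2 (\<lambda>m n. F (H m n))"
  unfolding total_rec_def total_rec2_def by (meson reval_Comp1)

lemma total_rec2_bin: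
  "total_rec2 H \<Longrightarrow> total_rec2 F \<Longrightarrow> total_rec2 G \<Longrightarrow> total_rec2 (\<lambda>m n. H (F m n) (G m n))"
  unfolding total_rec2_def by (meson reval_Comp2)

lemma total_rec2_fst: "total_rec2 (\<lambda>m n. m)"
  unfolding total_rec2_def using reval_Proj0 by blast

lemma total_rec2_snd: "total_rec2 (\<lambda>m n. n)"
  unfolding total_rec2_def using reval_Proj1 by blast

lemma total_rec2_add: "total_rec2 (+)"
proof -
  have "reval (PrimRec (Proj 0) (Comp Succ [Proj 1])) [m, n] (m + n)" for m n
  proof (induction m)
    case 0
    show ?case using reval_Proj0[of n "[]"] by (simp add: reval.PrimRec_0)
  next
    case (Suc m)
    show ?case
      by (rule reval.PrimRec_Suc[OF Suc], rule reval_Comp1[OF reval_Proj1]) (simp add: reval.Succ)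
  qed
  then show ?thesis unfolding total_rec2_def by blast
qed

lemma total_rec_pred: "total_rec (\<lambda>n. n - 1)"
proof -
  have "reval (PrimRec Zero (Proj 0)) [n] (n - 1)" for n
  proof (induction n)
    case 0
    show ?case by (simp add: reval.PrimRec_0 reval.Zero)
  next
    case (Suc n)
    show ?case by (rule reval.PrimRec_Suc[OF Suc]) (use reval_Proj0[of n] in simp)
  qed
  then show ?thesis unfolding total_rec_def by blast
qed

lemma total_rec2_diff: "total_rec2 (-)"
proof -
  obtain e where e: "\<And>n. reval e [n] (n - 1)"
    using total_rec_pred unfolding total_rec_def by blast
  have *: "reval (PrimRec (Proj 0) (Comp e [Proj 1])) [m, n] (n - m)" for m n
  proof (induction m)
    case 0
    show ?case using reval_Proj0[of n "[]"] by (simp add: reval.PrimRec_0)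
  next
    case (Suc m)
    show ?case
      by (rule reval.PrimRec_Suc[OF Suc], rule reval_Comp1[OF reval_Proj1]) (use e[of "n - m"] in simp)
  qed
  \<comment> \<open>\<open>PrimRec\<close> recurses on its first argument but subtraction recurses
    on the subtrahend, so the reversed difference was built and its arguments are exchanged
    here.\<close>
  have "reval (Comp (PrimRec (Proj 0) (Comp e [Proj 1])) [Proj 1, Proj 0]) [m, n] (m - n)" for m n
    by (rule reval_Comp2[OF reval_Proj1 reval_Proj0 *])
  then show ?thesis unfolding total_rec2_def by blast
qed

section \<open>The Cantor pairing and its inverse\<close>

lemma total_rec_triangle: "total_rec triangle"
proof -
  obtain e where e: "\<And>m n. reval e [m, n] (m + n)"
    using total_rec2_add unfolding total_rec2_def by blast
  have "reval (PrimRec Zero (Comp e [Proj 1, Comp Succ [Proj 0]])) [n] (triangle n)" for n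
  proof (induction n)
    case 0
    show ?case by (simp add: reval.PrimRec_0 reval.Zero)
  next
    case (Suc n)
    show ?case
      by (rule reval.PrimRec_Suc[OF Suc],
          rule reval_Comp2[OF reval_Proj1 reval_Comp1[OF reval_Proj0 reval.Succ]])
        (use e[of "triangle n" "Suc n"] in simp)
  qed
  then show ?thesis unfolding total_rec_def by blast
qed

lemma total_rec2_prod_encode: "total_rec2 (\<lambda>m n. prod_encode (m, n))"
proof -
  have "total_rec2 (\<lambda>m n. triangle (m + n) + m)"
    by (intro total_rec2_bin[OF total_rec2_add] total_rec2_comp[OF total_rec_triangle]
        total_rec2_fst total_rec2_snd)
  then show ?thesis by (simp add: prod_encode_def)
qed

lemma triangle_mono: "m \<le> n \<Longrightarrow> triangle m \<le> triangle n"
  by (induction rule: dec_induct) auto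

text \<open>A pair with sum \<open>s\<close> has its code from \<open>triangle s\<close> up to below
  \<open>triangle (Suc s)\<close>. Hence \<open>s\<close> is the least number at which the truncated
  difference \<open>Suc n - triangle (Suc s)\<close> vanishes, and minimization finds it.\<close>

lemma total_rec_prod_decode_sum:
  "total_rec (\<lambda>n. fst (prod_decode n) + snd (prod_decode n))"
proof -
  have "total_rec2 (\<lambda>s n. Suc n - triangle (Suc s))"
    by (intro total_rec2_bin[OF total_rec2_diff] total_rec2_comp[OF total_rec_triangle]
        total_rec2_comp[OF total_rec_Suc] total_rec2_fst total_rec2_snd)
  then obtain e where e: "\<And>s n. reval e [s, n] (Suc n - triangle (Suc s))"
    unfolding total_rec2_def by blast
  have "reval (Mu e) [n] (fst (prod_decode n) + snd (prod_decode n))" for n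
  proof -
    obtain a b where ab: "prod_decode n = (a, b)" by fastforce
    then have n: "n = triangle (a + b) + a"
      using prod_decode_inverse[of n] by (simp add: prod_encode_def)
    show ?thesis unfolding ab fst_conv snd_conv
    proof (rule reval.Mu)
      show "reval e [a + b, n] 0" using e[of "a + b" n] by (simp add: n)
    next
      fix m assume "m < a + b"
      then have "triangle (Suc m) \<le> triangle (a + b)" by (intro triangle_mono) simp
      then have "Suc n - triangle (Suc m) = Suc (n - triangle (Suc m))" using n by simp
      then show "\<exists>y. reval e [m, n] (Suc y)" using e[of m n] by metis
    qed
  qed
  then show ?thesis unfolding total_rec_def by blast
qed

lemma total_rec_prod_decode:
  "total_rec (\<lambda>n. fst (prod_decode n))" "total_rec (\<lambda>n. snd (prod_decode n))"
proof -
  let ?s = "\<lambda>n. fst (prod_decode n) + snd (prod_decode n)"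
  have eq: "n - triangle (?s n) = fst (prod_decode n)" for n
    using prod_decode_inverse[of n]
    by (cases "prod_decode n") (simp add: prod_encode_def)
  have "total_rec (\<lambda>n. n - triangle (?s n))"
    by (intro total_rec_bin[OF total_rec2_diff] total_rec_comp[OF total_rec_triangle]
        total_rec_id total_rec_prod_decode_sum)
  then show 1: "total_rec (\<lambda>n. fst (prod_decode n))" by (simp add: eq)
  have "total_rec (\<lambda>n. ?s n - fst (prod_decode n))"
    by (intro total_rec_bin[OF total_rec2_diff] 1 total_rec_prod_decode_sum)
  then show "total_rec (\<lambda>n. snd (prod_decode n))" by simp
qed

lemma total_rec_rec_nat:
  assumes "total_rec A" "total_rec S" "total_rec N"
  shows "total_rec (\<lambda>n. rec_nat (A n) (\<lambda>i r. S (prod_encode (n, prod_encode (i, r)))) (N n))"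
proof -
  obtain a s l c where e: "\<And>n. reval a [n] (A n)" "\<And>n. reval s [n] (S n)" "\<And>n. reval l [n] (N n)"
      "\<And>m n. reval c [m, n] (prod_encode (m, n))"
    using assms total_rec2_prod_encode unfolding total_rec_def total_rec2_def by metis
  \<comment> \<open>\<open>PrimRec\<close> supplies counter, previous value and parameter in this
    order, whereas \<open>S\<close> expects one code of parameter, counter and previous
    value.\<close>
  let ?g = "Comp s [Comp c [Proj 2, Comp c [Proj 0, Proj 1]]]"
  have *: "reval (PrimRec a ?g) [m, n]
      (rec_nat (A n) (\<lambda>i r. S (prod_encode (n, prod_encode (i, r)))) m)" for m n
  proof (induction m)
    case 0
    show ?case by (simp add: reval.PrimRec_0 e)
  next
    case (Suc m)
    show ?case
      by (rule reval.PrimRec_Suc[OF Suc])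
        (simp only: nat.rec, rule reval_Comp1[OF reval_Comp2[OF reval_Proj2
            reval_Comp2[OF reval_Proj0 reval_Proj1 e(4)] e(4)] e(2)])
  qed
  have "reval (Comp (PrimRec a ?g) [l, Proj 0]) [n]
      (rec_nat (A n) (\<lambda>i r. S (prod_encode (n, prod_encode (i, r)))) (N n))" for n
    by (rule reval_Comp2[OF e(3) reval_Proj0 *])
  then show ?thesis unfolding total_rec_def by blast
qed

section \<open>Computable functions between encoded types\<close>

text \<open>Only injectivity is demanded, because the prescribed codes of \<open>bool\<close>, and
  thus of letters, do not exhaust the numbers. Surjectivity is established separately for the types
  whose codes are searched.\<close>

class encodable =
  fixes encode :: "'a \<Rightarrow> nat"
  assumes encode_inject: "encode x = encode y \<Longrightarrow> x = y"

lemma encode_eq_iff [simp]: "encode x = encode y \<longleftrightarrow> x = y"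
  using encode_inject by blast

instantiation nat :: encodable
begin
definition encode_nat :: "nat \<Rightarrow> nat" where [simp]: "encode_nat n = n"
instance by standard simp
end

instantiation bool :: encodable
begin
definition encode_bool :: "bool \<Rightarrow> nat" where [simp]: "encode_bool b = of_bool b"
instance by standard (auto simp: of_bool_def split: if_splits)
end

instantiation prod :: (encodable, encodable) encodable
begin
definition encode_prod :: "'a \<times> 'b \<Rightarrow> nat" where
  "encode_prod p = prod_encode (encode (fst p), encode (snd p))"
instance by standard (auto simp: encode_prod_def prod_eq_iff)
end

instantiation list :: (encodable) encodable
begin
definition encode_list :: "'a list \<Rightarrow> nat" where
  "encode_list xs = list_encode (map encode xs)"
instance
proof
  fix xs ys :: "'a list"
  have "inj (encode :: 'a \<Rightarrow> nat)" by (rule injI) (rule encode_inject)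
  then show "encode xs = encode ys \<Longrightarrow> xs = ys"
    by (simp add: encode_list_def inj_list_encode[THEN inj_eq] inj_map_eq_map)
qed
end

lemma encode_Nil [simp]: "encode [] = 0"
  by (simp add: encode_list_def)

lemma encode_Cons: "encode (x # xs) = Suc (encode (x, xs))"
  by (simp add: encode_list_def encode_prod_def)

lemma surj_encode_nat: "surj (encode :: nat \<Rightarrow> nat)"
  by (rule surjI[where f = id]) simp

lemma surj_encode_prod:
  assumes "surj (encode :: 'a::encodable \<Rightarrow> nat)" "surj (encode :: 'b::encodable \<Rightarrow> nat)"
  shows "surj (encode :: 'a \<times> 'b \<Rightarrow> nat)"
proof (rule surjI)
  fix n
  show "encode ((inv_into UNIV encode (fst (prod_decode n)), inv_into UNIV encode (snd (prod_decode n))) :: 'a \<times> 'b) = n"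
    by (simp add: encode_prod_def surj_f_inv_f[OF assms(1)] surj_f_inv_f[OF assms(2)])
qed

lemma surj_encode_list:
  assumes "surj (encode :: 'a::encodable \<Rightarrow> nat)"
  shows "surj (encode :: 'a list \<Rightarrow> nat)"
proof (rule surjI)
  fix n
  show "encode (map (inv_into UNIV encode) (list_decode n) :: 'a list) = n"
    by (simp add: encode_list_def o_def surj_f_inv_f[OF assms])
qed

text \<open>Provides a number of iterations for \<open>computable_fold\<close> before
  \<open>length\<close> is known to be computable.\<close>

lemma length_le_encode: "length xs \<le> encode xs"
proof (induction xs)
  case (Cons x xs)
  have "encode xs \<le> encode (x, xs)" by (simp add: encode_prod_def le_prod_encode_2)
  with Cons show ?case by (simp add: encode_Cons)
qed simp

definition computable :: "('a::encodable \<Rightarrow> 'b::encodable) \<Rightarrow> bool" where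
  "computable f \<longleftrightarrow> (\<exists>F. total_rec F \<and> (\<forall>x. F (encode x) = encode (f x)))"

lemma computableI: "total_rec F \<Longrightarrow> (\<And>x. F (encode x) = encode (f x)) \<Longrightarrow> computable f"
  unfolding computable_def by blast

lemma computableE:
  assumes "computable f"
  obtains F where "total_rec F" "\<And>x. F (encode x) = encode (f x)"
  using assms unfolding computable_def by blast

named_theorems computable_intros

lemma computable_id [computable_intros]: "computable (\<lambda>x. x)"
  by (rule computableI[OF total_rec_id]) simp

lemma computable_const [computable_intros]: "computable (\<lambda>x. c)"
  by (rule computableI[OF total_rec_const]) simp

lemma computable_comp: "computable f \<Longrightarrow> computable g \<Longrightarrow> computable (\<lambda>x. f (g x))"
  by (elim computableE, rule computableI, erule (1) total_rec_comp) auto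

lemma computable_encode [computable_intros]: "computable f \<Longrightarrow> computable (\<lambda>x. encode (f x))"
  unfolding computable_def by simp

lemma computable_of_encode: "computable (\<lambda>x. encode (f x)) \<Longrightarrow> computable f"
  unfolding computable_def by simp

lemma computable_Pair [computable_intros]:
  assumes "computable f" "computable g"
  shows "computable (\<lambda>x. (f x, g x))"
proof -
  obtain F G where FG: "total_rec F" "\<And>x. F (encode x) = encode (f x)"
      "total_rec G" "\<And>x. G (encode x) = encode (g x)"
    using assms by (metis computableE)
  show ?thesis
    by (rule computableI[OF total_rec_bin[OF total_rec2_prod_encode FG(1,3)]])
      (simp add: FG encode_prod_def)
qed

lemma computable_fst [computable_intros]:
  assumes "computable f"
  shows "computable (\<lambda>x. fst (f x))"
proof (rule computable_comp[OF _ assms])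
  show "computable (\<lambda>p :: 'b \<times> 'c. fst p)"
    by (rule computableI[OF total_rec_prod_decode(1)]) (simp add: encode_prod_def)
qed

lemma computable_snd [computable_intros]:
  assumes "computable f"
  shows "computable (\<lambda>x. snd (f x))"
proof (rule computable_comp[OF _ assms])
  show "computable (\<lambda>p :: 'b \<times> 'c. snd p)"
    by (rule computableI[OF total_rec_prod_decode(2)]) (simp add: encode_prod_def)
qed

lemma computable_total_rec2:
  assumes "total_rec2 H" "computable f" "computable g"
  shows "computable (\<lambda>x. H (f x) (g x))"
proof -
  obtain F G where FG: "total_rec F" "\<And>x. F (encode x) = encode (f x)"
      "total_rec G" "\<And>x. G (encode x) = encode (g x)"
    using assms by (metis computableE)
  show ?thesis
    by (rule computableI[OF total_rec_bin[OF assms(1) FG(1,3)]]) (simp add: FG)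
qed

lemmas computable_add [computable_intros] = computable_total_rec2[OF total_rec2_add]
lemmas computable_diff [computable_intros] = computable_total_rec2[OF total_rec2_diff]

lemma computable_Suc [computable_intros]: "computable f \<Longrightarrow> computable (\<lambda>x. Suc (f x))"
  by (rule computable_comp[where f = Suc], rule computableI[OF total_rec_Suc]) auto

lemma computable_rec_nat [computable_intros]:
  fixes a :: "'a::encodable \<Rightarrow> 'b::encodable"
  assumes "computable a" "computable (\<lambda>p. s (fst p) (fst (snd p)) (snd (snd p)))" "computable l"
  shows "computable (\<lambda>x. rec_nat (a x) (s x) (l x))"
proof -
  obtain A S L where F: "total_rec A" "\<And>x. A (encode x) = encode (a x)"
      "total_rec S" "\<And>p. S (encode p) = encode (s (fst p) (fst (snd p)) (snd (snd p)))"
      "total_rec L" "\<And>x. L (encode x) = encode (l x)"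
    using assms by (elim computableE) blast
  have *: "rec_nat (A (encode x)) (\<lambda>i r. S (prod_encode (encode x, prod_encode (i, r)))) m
      = encode (rec_nat (a x) (s x) m)" for x m
    using F(4)[of "(x, i, r)" for i r] by (induction m) (auto simp: F(2) encode_prod_def)
  show ?thesis
    by (rule computableI[OF total_rec_rec_nat[OF F(1,3,5)]]) (simp add: * F(6))
qed

section \<open>Booleans, comparisons and arithmetic\<close>

lemma computable_if [computable_intros]:
  fixes b :: "'a::encodable \<Rightarrow> bool"
  assumes "computable b" "computable f" "computable g"
  shows "computable (\<lambda>x. if b x then f x else g x)"
proof -
  \<comment> \<open>The code of a Boolean is 0 or 1, so the recursion makes at most one step, and
    that step discards the start value.\<close>
  have "computable (\<lambda>x. rec_nat (g x) (\<lambda>_ _. f x) (encode (b x)))"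
    by (intro computable_intros assms computable_comp[OF assms(2)])
  moreover have "rec_nat (g x) (\<lambda>_ _. f x) (encode (b x)) = (if b x then f x else g x)" for x
    by simp
  ultimately show ?thesis by simp
qed

lemma computable_le [computable_intros]:
  fixes f g :: "'a::encodable \<Rightarrow> nat"
  assumes "computable f" "computable g"
  shows "computable (\<lambda>x. f x \<le> g x)"
proof -
  have "computable (\<lambda>x. rec_nat True (\<lambda>_ _. False) (f x - g x))"
    by (intro computable_intros assms)
  moreover have "rec_nat True (\<lambda>_ _. False) n = (n = 0)" for n by (cases n) auto
  ultimately show ?thesis by simp
qed

lemma computable_less [computable_intros]:
  fixes f g :: "'a::encodable \<Rightarrow> nat"
  assumes "computable f" "computable g"
  shows "computable (\<lambda>x. f x < g x)"
  using computable_le[OF computable_Suc[OF assms(1)] assms(2)] by (simp add: Suc_le_eq)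

lemma computable_conj [computable_intros]:
  assumes "computable P" "computable Q"
  shows "computable (\<lambda>x. P x \<and> Q x)"
proof -
  have "(if P x then Q x else False) = (P x \<and> Q x)" for x by simp
  then show ?thesis using computable_if[OF assms computable_const[of False]] by simp
qed

lemma computable_Not [computable_intros]:
  assumes "computable P"
  shows "computable (\<lambda>x. \<not> P x)"
proof -
  have "(if P x then False else True) = (\<not> P x)" for x by simp
  then show ?thesis
    using computable_if[OF assms computable_const[of False] computable_const[of True]] by simp
qed

lemma computable_imp [computable_intros]:
  assumes "computable P" "computable Q"
  shows "computable (\<lambda>x. P x \<longrightarrow> Q x)"
proof -
  have "(if P x then Q x else True) = (P x \<longrightarrow> Q x)" for x by simp
  then show ?thesis using computable_if[OF assms computable_const[of True]] by simp
qed

lemma computable_eq [computable_intros]: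
  assumes "computable f" "computable g"
  shows "computable (\<lambda>x. f x = g x)"
proof -
  have "computable (\<lambda>x. encode (f x) \<le> encode (g x) \<and> encode (g x) \<le> encode (f x))"
    by (intro computable_intros assms)
  then show ?thesis by (simp add: eq_iff[symmetric])
qed

lemma computable_mult [computable_intros]:
  fixes f g :: "'a::encodable \<Rightarrow> nat"
  assumes "computable f" "computable g"
  shows "computable (\<lambda>x. f x * g x)"
proof -
  have "computable (\<lambda>x. rec_nat 0 (\<lambda>_ r. g x + r) (f x))"
    by (intro computable_intros assms computable_comp[OF assms(2)])
  moreover have "rec_nat 0 (\<lambda>_ r. m + r) n = n * m" for m n :: nat by (induction n) auto
  ultimately show ?thesis by simp
qed

lemma computable_power [computable_intros]:
  fixes f g :: "'a::encodable \<Rightarrow> nat"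
  assumes "computable f" "computable g"
  shows "computable (\<lambda>x. f x ^ g x)"
proof -
  have "computable (\<lambda>x. rec_nat 1 (\<lambda>_ r. f x * r) (g x))"
    by (intro computable_intros assms computable_comp[OF assms(1)])
  moreover have "rec_nat 1 (\<lambda>_ r. m * r) n = m ^ n" for m n :: nat by (induction n) auto
  ultimately show ?thesis by simp
qed

section \<open>Lists\<close>

lemma computable_Cons [computable_intros]:
  assumes "computable f" "computable g"
  shows "computable (\<lambda>x. f x # g x)"
proof (rule computable_of_encode)
  show "computable (\<lambda>x. encode (f x # g x))"
    unfolding encode_Cons by (intro computable_intros assms)
qed

lemma computable_case_list [computable_intros]:
  fixes a :: "'a::encodable \<Rightarrow> 'b::encodable" and l :: "'a \<Rightarrow> 'c::encodable list"
  assumes "computable a" "computable (\<lambda>p. s (fst p) (fst (snd p)) (snd (snd p)))" "computable l"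
  shows "computable (\<lambda>x. case l x of [] \<Rightarrow> a x | y # ys \<Rightarrow> s x y ys)"
proof -
  obtain A S L where F: "total_rec A" "\<And>x. A (encode x) = encode (a x)"
      "total_rec S" "\<And>p. S (encode p) = encode (s (fst p) (fst (snd p)) (snd (snd p)))"
      "total_rec L" "\<And>x. L (encode x) = encode (l x)"
    using assms by (elim computableE) blast
  let ?S = "\<lambda>q. S (prod_encode (fst (prod_decode q), fst (prod_decode (snd (prod_decode q)))))"
  have S: "total_rec ?S"
    by (intro total_rec_comp[OF F(3)] total_rec_bin[OF total_rec2_prod_encode] total_rec_prod_decode
        total_rec_comp[OF total_rec_prod_decode(1)])
  show ?thesis
    by (rule computableI[OF total_rec_rec_nat[OF F(1) S F(5)]])
      (use F(4)[of "(x, y, ys)" for x y ys] in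
        \<open>auto simp: F(2,6) encode_prod_def encode_Cons split: list.split\<close>)
qed

lemma computable_fold [computable_intros]:
  fixes a :: "'a::encodable \<Rightarrow> 'b::encodable" and l :: "'a \<Rightarrow> 'c::encodable list"
  assumes "computable (\<lambda>p. s (fst p) (fst (snd p)) (snd (snd p)))" "computable l" "computable a"
  shows "computable (\<lambda>x. fold (s x) (l x) (a x))"
proof -
  \<comment> \<open>The state is the list still to be read together with the accumulator. Once the
    list is empty the step is idle, so too many iterations do no harm.\<close>
  let ?step = "\<lambda>x (_::nat) q. case fst q of [] \<Rightarrow> q | y # ys \<Rightarrow> (ys, s x y (snd q))"
  have s: "computable (\<lambda>p. s (f p) (g p) (h p))"
    if "computable f" "computable g" "computable h" for f :: "'d::encodable \<Rightarrow> 'a" and g h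
    using computable_comp[OF assms(1) computable_Pair[OF that(1) computable_Pair[OF that(2,3)]]]
    by simp
  have "computable (\<lambda>x. snd (rec_nat (l x, a x) (?step x) (encode (l x))))"
    by (intro computable_intros s assms)
  moreover have *: "rec_nat (ys, b) (?step x) n = (drop n ys, fold (s x) (take n ys) b)" for x ys b n
  proof (induction n)
    case (Suc n)
    show ?case
    proof (cases "n < length ys")
      case True
      then have "drop n ys = ys ! n # drop (Suc n) ys" "take (Suc n) ys = take n ys @ [ys ! n]"
        by (simp_all add: Cons_nth_drop_Suc take_Suc_conv_app_nth)
      with Suc show ?thesis by simp
    next
      case False
      with Suc show ?thesis by simp
    qed
  qed simp
  ultimately show ?thesis by (simp add: length_le_encode)
qed

lemma computable_rev [computable_intros]:
  assumes "computable f"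
  shows "computable (\<lambda>x. rev (f x))"
proof -
  have "computable (\<lambda>x. fold Cons (f x) [])" by (intro computable_intros assms)
  then show ?thesis by (simp add: fold_Cons_rev)
qed

lemma computable_foldr [computable_intros]:
  assumes "computable (\<lambda>p. s (fst p) (fst (snd p)) (snd (snd p)))" "computable l" "computable a"
  shows "computable (\<lambda>x. foldr (s x) (l x) (a x))"
  unfolding foldr_conv_fold by (intro computable_intros assms)

lemma computable_append [computable_intros]:
  assumes "computable f" "computable g"
  shows "computable (\<lambda>x. f x @ g x)"
proof -
  have "computable (\<lambda>x. foldr Cons (f x) (g x))" by (intro computable_intros assms)
  moreover have "foldr Cons xs ys = xs @ ys" for xs ys :: "'b list" by (induction xs) auto
  ultimately show ?thesis by simp
qed

lemma computable_length [computable_intros]: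
  assumes "computable f"
  shows "computable (\<lambda>x. length (f x))"
proof -
  have "computable (\<lambda>x. foldr (\<lambda>_ n. Suc n) (f x) 0)" by (intro computable_intros assms)
  moreover have "foldr (\<lambda>_ n. Suc n) xs 0 = length xs" for xs :: "'b list" by (induction xs) auto
  ultimately show ?thesis by simp
qed

lemma computable_map [computable_intros]:
  assumes "computable (\<lambda>p. s (fst p) (snd p))" "computable l"
  shows "computable (\<lambda>x. map (s x) (l x))"
proof -
  have s: "computable (\<lambda>p. s (f p) (g p))" if "computable f" "computable g"
    for f :: "'d::encodable \<Rightarrow> 'a" and g
    using computable_comp[OF assms(1) computable_Pair[OF that]] by simp
  have "computable (\<lambda>x. foldr (\<lambda>y ys. s x y # ys) (l x) [])"
    by (intro computable_intros s assms)
  moreover have "foldr (\<lambda>y ys. h y # ys) xs [] = map h xs" for h :: "'b \<Rightarrow> 'c" and xs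
    by (induction xs) auto
  ultimately show ?thesis by simp
qed

lemma computable_concat [computable_intros]:
  assumes "computable l"
  shows "computable (\<lambda>x. concat (l x))"
  unfolding concat_conv_foldr by (intro computable_intros assms)

lemma computable_list_all [computable_intros]:
  assumes "computable (\<lambda>p. s (fst p) (snd p))" "computable l"
  shows "computable (\<lambda>x. list_all (s x) (l x))"
proof -
  have s: "computable (\<lambda>p. s (f p) (g p))" if "computable f" "computable g"
    for f :: "'d::encodable \<Rightarrow> 'a" and g
    using computable_comp[OF assms(1) computable_Pair[OF that]] by simp
  have "computable (\<lambda>x. foldr (\<lambda>y b. s x y \<and> b) (l x) True)"
    by (intro computable_intros s assms)
  moreover have "foldr (\<lambda>y b. h y \<and> b) xs True = list_all h xs" for h :: "'b \<Rightarrow> bool" and xs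
    by (induction xs) auto
  ultimately show ?thesis by simp
qed

lemma computable_drop [computable_intros]:
  assumes "computable f" "computable g"
  shows "computable (\<lambda>x. drop (f x) (g x))"
proof -
  have "computable (\<lambda>x. rec_nat (g x) (\<lambda>_ ys. case ys of [] \<Rightarrow> [] | z # zs \<Rightarrow> zs) (f x))"
    by (intro computable_intros assms)
  moreover have "rec_nat xs (\<lambda>_ ys. case ys of [] \<Rightarrow> [] | z # zs \<Rightarrow> zs) n = drop n xs"
    for n and xs :: "'b list"
    by (induction n) (auto simp: drop_Suc tl_drop[symmetric] split: list.split)
  ultimately show ?thesis by simp
qed

text \<open>The encoding of witnesses must be onto so that every number met by the search is the code of a
  candidate.\<close>

lemma computable_search:
  fixes P :: "'a::encodable \<Rightarrow> 'b::encodable \<Rightarrow> bool" and h :: "'b \<Rightarrow> 'c::encodable"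
  assumes "computable (\<lambda>p. P (fst p) (snd p))" "computable h" "surj (encode :: 'b \<Rightarrow> nat)"
  shows "\<exists>e. \<forall>x. (\<exists>y. P x y) \<longrightarrow> (\<exists>y. P x y \<and> reval e [encode x] (encode (h y)))"
proof -
  obtain F where F: "total_rec F" "\<And>p. F (encode p) = encode (\<not> P (fst p) (snd p))"
    using computableE[OF computable_Not[OF assms(1)]] by blast
  obtain H where H: "total_rec H" "\<And>y. H (encode y) = encode (h y)"
    using computableE[OF assms(2)] by blast
  have "total_rec2 (\<lambda>m n. F (prod_encode (n, m)))"
    by (intro total_rec2_comp[OF F(1)] total_rec2_bin[OF total_rec2_prod_encode]
        total_rec2_fst total_rec2_snd)
  then obtain e where e: "\<And>m n. reval e [m, n] (F (prod_encode (n, m)))"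
    unfolding total_rec2_def by blast
  obtain e' where e': "\<And>n. reval e' [n] (H n)" using H(1) unfolding total_rec_def by blast
  define dec where "dec = (inv_into UNIV encode :: nat \<Rightarrow> 'b)"
  have dec: "encode (dec n) = n" for n by (simp add: dec_def surj_f_inv_f[OF assms(3)])
  have F_dec: "F (prod_encode (encode x, m)) = of_bool (\<not> P x (dec m))" for x m
    using F(2)[of "(x, dec m)"] by (simp add: encode_prod_def dec)
  have "\<exists>y. P x y \<and> reval (Comp e' [Mu e]) [encode x] (encode (h y))" if "\<exists>y. P x y" for x
  proof -
    define m where "m = (LEAST m. P x (dec m))"
    from that have "\<exists>m. P x (dec m)" by (metis dec encode_inject)
    then have m: "P x (dec m)" unfolding m_def by (rule LeastI_ex)
    have "reval (Mu e) [encode x] m"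
    proof (rule reval.Mu)
      show "reval e [m, encode x] 0" using e[of m "encode x"] m by (simp add: F_dec)
      show "\<exists>y. reval e [i, encode x] (Suc y)" if "i < m" for i
        using e[of i "encode x"] not_less_Least[OF that[unfolded m_def]] by (auto simp: F_dec)
    qed
    then have "reval (Comp e' [Mu e]) [encode x] (encode (h (dec m)))"
      using reval_Comp1 e'[of m] H(2)[of "dec m"] by (simp add: dec)
    with m show ?thesis by blast
  qed
  then show ?thesis by blast
qed

section \<open>Words and free reduction\<close>

definition inv_word :: "word \<Rightarrow> word" where
  "inv_word u = rev (map inv_letter u)"

lemma inv_word_simps [simp]:
  "inv_word [] = []" "inv_word (x # u) = inv_word u @ [inv_letter x]"
  "inv_word (u @ v) = inv_word v @ inv_word u" "inv_word (inv_word u) = u"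
  "length (inv_word u) = length u" "inv_word u = [] \<longleftrightarrow> u = []"
  by (simp_all add: inv_word_def rev_map o_def)

lemma hd_inv_word: "u \<noteq> [] \<Longrightarrow> hd (inv_word u) = inv_letter (last u)"
  by (simp add: inv_word_def hd_rev last_map)

lemma last_inv_word: "u \<noteq> [] \<Longrightarrow> last (inv_word u) = inv_letter (hd u)"
  by (simp add: inv_word_def last_rev hd_map)

lemma reduced_append:
  "reduced (u @ v) \<longleftrightarrow> reduced u \<and> reduced v \<and> (u \<noteq> [] \<and> v \<noteq> [] \<longrightarrow> hd v \<noteq> inv_letter (last u))"
proof (induction u)
  case (Cons x u)
  then show ?case by (cases u; cases v) auto
qed simp

lemma reduced_inv_word [simp]: "reduced (inv_word u) \<longleftrightarrow> reduced u"
proof -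
  have *: "reduced u \<Longrightarrow> reduced (inv_word u)" for u
  proof (induction u)
    case (Cons x u)
    then show ?case
      using reduced_append[of "[x]" u]
      by (cases u) (auto simp: reduced_append last_inv_word)
  qed simp
  from *[of u] *[of "inv_word u"] show ?thesis by auto
qed

lemma free_reduce_append: "free_reduce (u @ v) = foldr push u (free_reduce v)"
  by (simp add: free_reduce_def)

lemma reduced_free_reduce [simp]: "reduced (free_reduce u)"
  by (simp add: free_reduce_def foldr_push_reduced)

lemma free_reduce_id [simp]: "reduced u \<Longrightarrow> free_reduce u = u"
  by (simp add: free_reduce_def foldr_push_id)

lemma free_reduce_right [simp]: "free_reduce (u @ free_reduce v) = free_reduce (u @ v)"
  by (simp add: free_reduce_append)

lemma free_reduce_left [simp]: "free_reduce (free_reduce u @ v) = free_reduce (u @ v)"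
  using foldr_push_foldr[of "free_reduce v" u "[]"]
  by (simp add: free_reduce_append free_reduce_def[of u])

lemma free_reduce_cong:
  "free_reduce u = free_reduce u' \<Longrightarrow> free_reduce v = free_reduce v' \<Longrightarrow>
    free_reduce (u @ v) = free_reduce (u' @ v')"
  by (metis free_reduce_left free_reduce_right)

lemma foldr_push_inv_word:
  "reduced w \<Longrightarrow> foldr push (inv_word u) (foldr push u w) = w"
  "reduced w \<Longrightarrow> foldr push u (foldr push (inv_word u) w) = w"
  using foldr_push_inv[of w u] foldr_push_inv[of w "inv_word u"]
  by (simp_all add: inv_word_def rev_map o_def)

text \<open>Turns equations between free reductions into equations between iterated \<open>push\<close>es, where
  cancellation is rewriting.\<close>

lemmas free_reduce_simps =
  free_reduce_def foldr_append foldr_push_foldr foldr_push_inv_word foldr_push_reduced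

lemma free_reduce_inv_word_cancel [simp]:
  "free_reduce (inv_word u @ u @ v) = free_reduce v"
  "free_reduce (u @ inv_word u @ v) = free_reduce v"
  by (simp_all add: free_reduce_simps)

lemma free_reduce_inv_word_cancel' [simp]:
  "free_reduce (inv_word u @ u) = []" "free_reduce (u @ inv_word u) = []"
  using free_reduce_inv_word_cancel[of u "[]"] by simp_all

lemma free_reduce_inv_word: "free_reduce (inv_word u) = inv_word (free_reduce u)"
proof -
  \<comment> \<open>The product is evaluated in two ways, by cancelling its last two factors or its
    first two.\<close>
  have "free_reduce (inv_word u @ free_reduce u @ inv_word (free_reduce u)) = free_reduce (inv_word u)"
    by (simp only: free_reduce_inv_word_cancel append_Nil2
        free_reduce_inv_word_cancel(2)[of _ "[]", simplified append_Nil2] free_reduce_cong)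
  moreover have "free_reduce (inv_word u @ free_reduce u @ inv_word (free_reduce u))
      = inv_word (free_reduce u)"
  proof -
    have "free_reduce (inv_word u @ free_reduce u @ v) = free_reduce v" for v
      by (simp add: free_reduce_simps)
    then show ?thesis by simp
  qed
  ultimately show ?thesis by simp
qed

lemma length_push: "length (push x w) \<le> Suc (length w)"
  by (cases w) auto

lemma length_free_reduce: "length (free_reduce u) \<le> length u"
proof (induction u)
  case (Cons x u)
  then show ?case using length_push[of x "free_reduce u"] by (simp add: free_reduce_def)
qed (simp add: free_reduce_def)

lemma length_free_reduce_append:
  "length (free_reduce (u @ v)) \<le> length (free_reduce u) + length (free_reduce v)"
  using length_free_reduce[of "free_reduce u @ free_reduce v"] by simp

lemma length_free_reduce_inv_word [simp]:
  "length (free_reduce (inv_word u)) = length (free_reduce u)"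
  by (simp add: free_reduce_inv_word)

lemma words_append [simp]: "u @ v \<in> words k \<longleftrightarrow> u \<in> words k \<and> v \<in> words k"
  by (auto simp: words_def)

lemma words_Cons [simp]: "x # v \<in> words k \<longleftrightarrow> fst x < k \<and> v \<in> words k"
  by (auto simp: words_def)

lemma words_inv_word [simp]: "inv_word u \<in> words k \<longleftrightarrow> u \<in> words k"
  by (auto simp: words_def inv_word_def)

lemma reduced_cancellation:
  assumes "reduced u" "reduced v"
  obtains p s q where "u = p @ s" "v = inv_word s @ q" "free_reduce (u @ v) = p @ q" "reduced (p @ q)"
proof -
  have "\<exists>p s q. u = p @ s \<and> v = inv_word s @ q \<and> reduced (p @ q)"
    using assms
  proof (induction u arbitrary: v rule: rev_induct)
    case (snoc x u)
    show ?case
    proof (cases "reduced ((u @ [x]) @ v)")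
      case True
      then show ?thesis by (intro exI[of _ "u @ [x]"] exI[of _ "[]"] exI[of _ v]) simp
    next
      case False
      then obtain v' where v: "v = inv_letter x # v'"
        using snoc.prems by (cases v) (auto simp: reduced_append)
      have "reduced u" "reduced v'" using snoc.prems v by (auto simp: reduced_append dest: reduced_ConsD)
      from snoc.IH[OF this] obtain p s q where "u = p @ s" "v' = inv_word s @ q" "reduced (p @ q)"
        by blast
      then show ?thesis
        by (intro exI[of _ p] exI[of _ "s @ [x]"] exI[of _ q]) (simp add: v)
    qed
  qed auto
  then obtain p s q where *: "u = p @ s" "v = inv_word s @ q" "reduced (p @ q)" by blast
  have "free_reduce (u @ v) = free_reduce (p @ q)" by (simp add: * free_reduce_simps)
  also have "\<dots> = p @ q" using *(3) by simp
  finally show ?thesis using * that by blast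
qed

section \<open>Cyclic reduction and conjugacy length\<close>

definition word_power :: "nat \<Rightarrow> word \<Rightarrow> word" where
  "word_power n w = concat (replicate n w)"

lemma word_power_simps [simp]:
  "word_power 0 w = []" "word_power (Suc n) w = w @ word_power n w"
  by (simp_all add: word_power_def)

lemma word_power_Nil [simp]: "word_power n [] = []"
  by (induction n) simp_all

lemma word_power_add: "word_power (m + n) w = word_power m w @ word_power n w"
  by (simp add: word_power_def replicate_add)

lemma word_power_commute: "word_power n w @ w = w @ word_power n w"
  using word_power_add[of n 1 w] word_power_add[of 1 n w] by simp

lemma length_word_power [simp]: "length (word_power n w) = n * length w"
  by (induction n) auto

lemma word_power_words: "w \<in> words k \<Longrightarrow> word_power n w \<in> words k"
  by (induction n) simp_all

lemma word_power_rotate: "word_power n (x @ y) @ x = x @ word_power n (y @ x)"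
  by (induction n) simp_all

lemma free_reduce_word_power_cong:
  "free_reduce u = free_reduce v \<Longrightarrow> free_reduce (word_power n u) = free_reduce (word_power n v)"
  by (induction n) (auto intro: free_reduce_cong)

lemma free_reduce_word_power_conj:
  "free_reduce (word_power n (h @ c @ inv_word h)) = free_reduce (h @ word_power n c @ inv_word h)"
  by (induction n) (simp_all add: free_reduce_simps)

lemma cyc_reduced_Nil [simp]: "cyc_reduced []"
  by (simp add: cyc_reduced_def)

lemma cyc_reduced_iff: "cyc_reduced c \<longleftrightarrow> reduced (c @ c)"
  by (auto simp: cyc_reduced_def reduced_append)

lemma cyc_reduced_rotate: "cyc_reduced (x @ y) \<longleftrightarrow> cyc_reduced (y @ x)"
  by (cases "x = []"; cases "y = []") (auto simp: cyc_reduced_def reduced_append)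

lemma reduced_word_power:
  assumes "cyc_reduced c"
  shows "reduced (word_power n c)"
proof (cases "c = []")
  case True
  then show ?thesis by (induction n) simp_all
next
  case False
  have ne: "word_power (Suc n) c \<noteq> [] \<and> hd (word_power (Suc n) c) = hd c" for n
    using False by simp
  show ?thesis
  proof (induction n)
    case (Suc n)
    show ?case
    proof (cases n)
      case 0
      then show ?thesis using assms by (simp add: cyc_reduced_def)
    next
      case (Suc m)
      with \<open>reduced (word_power n c)\<close> ne[of m] assms show ?thesis
        by (auto simp: reduced_append cyc_reduced_def)
    qed
  qed simp
qed

lemma cyc_reduced_word_power: "cyc_reduced c \<Longrightarrow> cyc_reduced (word_power n c)"
  unfolding cyc_reduced_iff[of "word_power n c"] word_power_add[symmetric] by (rule reduced_word_power)

lemma reduced_conj_word_power: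
  assumes "reduced (h @ c @ inv_word h)" "cyc_reduced c" "c \<noteq> []" "n > 0"
  shows "reduced (h @ word_power n c @ inv_word h)"
proof -
  from assms obtain m where m: "n = Suc m" by (cases n) auto
  have l: "last (word_power n c) = last c"
    unfolding m word_power_simps word_power_commute[symmetric] using assms(3) by simp
  have h: "hd (word_power n c) = hd c" "word_power n c \<noteq> []" using assms(3) by (simp_all add: m)
  show ?thesis using assms(1,3) reduced_word_power[OF assms(2), of n] h l
    by (auto simp: reduced_append)
qed

lemma reduced_core:
  assumes "reduced g"
  obtains h c where "g = h @ c @ inv_word h" "cyc_reduced c" "g \<noteq> [] \<Longrightarrow> c \<noteq> []"
proof -
  have "\<exists>h c. g = h @ c @ inv_word h \<and> cyc_reduced c \<and> (g \<noteq> [] \<longrightarrow> c \<noteq> [])"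
    using assms
  proof (induction g rule: length_induct)
    case (1 g)
    show ?case
    proof (cases "cyc_reduced g")
      case True
      then show ?thesis by (intro exI[of _ "[]"] exI[of _ g]) simp
    next
      case False
      with 1 have *: "g \<noteq> []" "hd g = inv_letter (last g)" by (auto simp: cyc_reduced_def)
      then obtain x g1 where g1: "g = x # g1" by (cases g) auto
      with * have "g1 \<noteq> []" by auto
      then obtain g2 y where g2: "g1 = g2 @ [y]" by (metis rev_exhaust)
      have y: "y = inv_letter x" using * by (simp add: g1 g2)
      have "reduced g2" using 1(2) by (auto simp: g1 g2 reduced_append dest: reduced_ConsD)
      moreover have "g2 \<noteq> []" using 1(2) by (auto simp: g1 g2 y)
      ultimately obtain h c where "g2 = h @ c @ inv_word h" "cyc_reduced c" "c \<noteq> []"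
        using 1(1)[rule_format, of g2] by (auto simp: g1 g2)
      then show ?thesis by (intro exI[of _ "x # h"] exI[of _ c]) (simp add: g1 g2 y)
    qed
  qed
  then show ?thesis using that by metis
qed

text \<open>For \<open>g = h c h\<inverse>\<close> with \<open>c\<close> cyclically reduced, \<open>g\<^sup>2 = h c\<^sup>2 h\<inverse>\<close> exceeds \<open>g\<close> in length by
  that of \<open>c\<close>.\<close>

definition conj_length :: "word \<Rightarrow> nat" where
  "conj_length w = length (free_reduce (w @ w)) - length (free_reduce w)"

lemma conj_length_cong: "free_reduce u = free_reduce v \<Longrightarrow> conj_length u = conj_length v"
  unfolding conj_length_def by (metis free_reduce_cong)

lemma conj_length_cyc_reduced [simp]: "cyc_reduced c \<Longrightarrow> conj_length c = length c"
  by (simp add: conj_length_def cyc_reduced_iff reduced_append)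

text \<open>A nontrivial \<open>g\<close> with reduced form \<open>h c h\<inverse>\<close> and
  \<open>c\<close> cyclically reduced has powers of reduced length
  \<open>n * length c + 2 * length h\<close>. Thus \<open>conj_length\<close> is the growth rate of
  the powers, and any estimate of these with a bounded error yields an estimate of
  \<open>conj_length\<close>.\<close>

lemma word_power_length_bounds:
  obtains B where "\<And>n. n * conj_length g \<le> length (free_reduce (word_power n g))"
    "\<And>n. length (free_reduce (word_power n g)) \<le> n * conj_length g + B"
proof -
  obtain h c where hc: "free_reduce g = h @ c @ inv_word h" "cyc_reduced c"
      "free_reduce g \<noteq> [] \<Longrightarrow> c \<noteq> []"
    using reduced_core[OF reduced_free_reduce] by metis
  have gn: "free_reduce (word_power n g) = free_reduce (h @ word_power n c @ inv_word h)" for n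
    using free_reduce_word_power_cong[of g "free_reduce g" n] free_reduce_word_power_conj[of n h c]
    by (simp only: hc(1)) (simp only: hc(1)[symmetric] free_reduce_id reduced_free_reduce)
  show ?thesis
  proof (cases "free_reduce g = []")
    case True
    then have "h = []" "c = []" using hc(1) by simp_all
    then have "free_reduce (word_power n g) = []" for n using gn[of n]
      by simp
    moreover have "conj_length g = 0"
      using free_reduce_cong[of g "[]" g "[]"] True by (simp add: conj_length_def)
    ultimately show ?thesis by (intro that[of 0]) simp_all
  next
    case False
    then have "c \<noteq> []" using hc(3) by simp
    then have "length (free_reduce (word_power n g)) = n * length c + 2 * length h" if "n > 0" for n
      using gn[of n] reduced_conj_word_power[of h c n] hc(1,2) that reduced_free_reduce[of g]
      by simp
    note len = this this[of 1, simplified] this[of 2, simplified]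
    have "conj_length g = length c"
      using len(2,3) by (simp add: conj_length_def numeral_2_eq_2)
    then show ?thesis
      by (intro that[of "2 * length h"]; use len(1) in \<open>case_tac "n = 0"; simp\<close>)
  qed
qed

lemma conj_length_le: "conj_length g \<le> length (free_reduce g)"
  using word_power_length_bounds[of g] by (metis One_nat_def append_Nil2 nat_mult_1 word_power_simps)

lemma le_if_mult_le_add:
  fixes a b K :: nat
  assumes "\<And>n. n * a \<le> n * b + K"
  shows "a \<le> b"
proof (rule ccontr)
  assume "\<not> a \<le> b"
  then have "Suc K * Suc b \<le> Suc K * a" by (intro mult_le_mono2) simp
  with assms[of "Suc K"] show False by simp
qed

text \<open>Conjugation by \<open>h\<close> changes the length of every power by at most
  \<open>2 * length h\<close>, independently of the exponent, so the growth rate cannot increase;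
  undoing the conjugation gives the other inequality.\<close>

lemma conj_length_conj: "conj_length (h @ g @ inv_word h) = conj_length g"
proof -
  have *: "conj_length (h @ g @ inv_word h) \<le> conj_length g" for h g
  proof -
    let ?g' = "h @ g @ inv_word h"
    obtain B where B: "\<And>n. length (free_reduce (word_power n g)) \<le> n * conj_length g + B"
      using word_power_length_bounds[of g] by metis
    have 1: "n * conj_length ?g' \<le> length (free_reduce (word_power n ?g'))" for n
      using word_power_length_bounds[of ?g'] by metis
    have "n * conj_length ?g' \<le> n * conj_length g + (B + 2 * length h)" for n
    proof -
      have "length (free_reduce (h @ word_power n g @ inv_word h))
          \<le> length (free_reduce h) + (length (free_reduce (word_power n g)) + length (free_reduce (inv_word h)))"
        by (meson add_left_mono length_free_reduce_append order_trans)
      also have "\<dots> \<le> length h + (n * conj_length g + B + length h)"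
        using length_free_reduce[of h] B[of n] by (intro add_mono) simp_all
      finally show ?thesis using 1[of n] by (simp add: free_reduce_word_power_conj)
    qed
    then show ?thesis by (rule le_if_mult_le_add)
  qed
  have "conj_length g = conj_length (inv_word h @ (h @ g @ inv_word h) @ inv_word (inv_word h))"
    by (rule conj_length_cong) (simp add: free_reduce_simps)
  with *[of h g] *[of "inv_word h" "h @ g @ inv_word h"] show ?thesis by simp
qed

lemma conj_length_commute: "conj_length (u @ v) = conj_length (v @ u)"
proof -
  have "free_reduce (v @ (u @ v) @ inv_word v) = free_reduce (v @ u)"
    by (simp add: free_reduce_simps)
  from conj_length_cong[OF this] show ?thesis using conj_length_conj[of v "u @ v"] by simp
qed

section \<open>Bounded cancellation\<close>

text \<open>Images are concatenated without reduction, which keeps \<open>append\<close> and powers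
  strictly compatible; reduction is applied only where lengths are compared.\<close>

definition ext :: "(letter \<Rightarrow> word) \<Rightarrow> word \<Rightarrow> word" where
  "ext f w = concat (map f w)"

lemma ext_simps [simp]:
  "ext f [] = []" "ext f (x # w) = f x @ ext f w" "ext f (u @ v) = ext f u @ ext f v"
  by (simp_all add: ext_def)

lemma ext_word_power: "ext f (word_power n w) = word_power n (ext f w)"
  by (induction n) simp_all

locale letter_map =
  fixes f :: "letter \<Rightarrow> word"
  assumes map_inv: "f (inv_letter x) = inv_word (f x)"
begin

lemma ext_inv_word: "ext f (inv_word w) = inv_word (ext f w)"
  by (induction w) (simp_all add: map_inv)

lemma ext_push: "free_reduce (ext f (push x w)) = free_reduce (f x @ ext f w)"
  by (cases w) (auto simp: map_inv)

lemma ext_free_reduce: "free_reduce (ext f (free_reduce w)) = free_reduce (ext f w)"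
proof (induction w)
  case (Cons x w)
  have "free_reduce (ext f (free_reduce (x # w))) = free_reduce (f x @ ext f (free_reduce w))"
    using ext_push[of x "free_reduce w"] by (simp add: free_reduce_def)
  also have "\<dots> = free_reduce (ext f (x # w))"
    by (simp add: free_reduce_cong[OF refl Cons])
  finally show ?case .
qed (simp add: free_reduce_def)

lemma ext_cong: "free_reduce u = free_reduce v \<Longrightarrow> free_reduce (ext f u) = free_reduce (ext f v)"
  by (metis ext_free_reduce)

end

lemma append_eq_appendD_prefix: "a @ b = c @ d \<Longrightarrow> length c \<le> length a \<Longrightarrow> \<exists>t. a = c @ t \<and> d = t @ b"
  by (auto simp: append_eq_append_conv2)

lemma append_eq_appendD_suffix: "a @ b = c @ d \<Longrightarrow> length d \<le> length b \<Longrightarrow> \<exists>t. b = t @ d \<and> c = a @ t"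
proof -
  assume *: "a @ b = c @ d" "length d \<le> length b"
  moreover from *(1) have "length a + length b = length c + length d" by (metis length_append)
  ultimately have "length a \<le> length c" by simp
  with *(1) show ?thesis using append_eq_appendD_prefix[of c d a b] by auto
qed

text \<open>\<open>f\<close> and \<open>g\<close> give mutually inverse automorphisms of the free group on infinitely many letters;
  an automorphism of finite rank is prolonged by the identity on the other letters.\<close>

locale aut_pair = f: letter_map f + g: letter_map g for f g +
  fixes D :: nat
  assumes gf: "free_reduce (ext g (ext f w)) = free_reduce w"
    and fg: "free_reduce (ext f (ext g w)) = free_reduce w"
    and length_f: "length (f x) \<le> D" and length_g: "length (g x) \<le> D"
begin

lemma length_ext_f: "length (ext f w) \<le> D * length w"
  by (induction w) (simp_all add: length_f add_mono)

lemma length_ext_g: "length (ext g w) \<le> D * length w"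
  by (induction w) (simp_all add: length_g add_mono)

text \<open>Since \<open>g\<close> recovers \<open>w\<close> and stretches by at most
  \<open>D\<close>, the image under \<open>f\<close> cannot be too short. This is the lower half of
  a quasi-isometry estimate.\<close>

lemma length_le_ext:
  assumes "reduced w"
  shows "length w \<le> D * length (free_reduce (ext f w))"
proof -
  have "w = free_reduce (ext g (free_reduce (ext f w)))"
    using assms by (simp add: g.ext_free_reduce gf)
  then have "length w \<le> length (ext g (free_reduce (ext f w)))"
    by (metis length_free_reduce)
  also have "\<dots> \<le> D * length (free_reduce (ext f w))" by (rule length_ext_g)
  finally show ?thesis .
qed

text \<open>The images of successive prefixes of \<open>v\<close> move through the tree in jumps of
  length at most \<open>D\<close>. The geodesic to the last one passes through \<open>p\<close>, and
  in a tree such a sequence cannot get past \<open>p\<close> without coming within \<open>D\<close>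
  of it.\<close>

lemma prefix_near_image:
  assumes "free_reduce (ext f v) = p @ r"
  shows "\<exists>v1 v2. v = v1 @ v2 \<and> length (free_reduce (inv_word p @ ext f v1)) \<le> D"
  using assms
proof (induction v arbitrary: r rule: rev_induct)
  case Nil
  then show ?case by simp
next
  case (snoc x v)
  obtain a s q where *: "free_reduce (ext f v) = a @ s" "free_reduce (f x) = inv_word s @ q"
      "free_reduce (free_reduce (ext f v) @ free_reduce (f x)) = a @ q"
    using reduced_cancellation[OF reduced_free_reduce reduced_free_reduce] by metis
  have eq: "a @ q = p @ r" using snoc.prems *(3) by simp
  show ?case
  proof (cases "length p \<le> length a")
    case True
    from append_eq_appendD_prefix[OF eq this] obtain t where "a = p @ t" by blast
    then have "free_reduce (ext f v) = p @ (t @ s)" using * by simp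
    from snoc.IH[OF this] show ?thesis by (metis append.assoc)
  next
    case False
    moreover from eq have "length a + length q = length p + length r" by (metis length_append)
    ultimately have "length r \<le> length q" by simp
    from append_eq_appendD_suffix[OF eq this] obtain t where t: "q = t @ r" by blast
    have "free_reduce (inv_word p @ ext f (v @ [x])) = free_reduce (inv_word p @ free_reduce (ext f (v @ [x])))"
      by simp
    also have "\<dots> = free_reduce r" unfolding snoc.prems by simp
    finally have "length (free_reduce (inv_word p @ ext f (v @ [x]))) \<le> length r"
      by (simp add: length_free_reduce)
    also have "\<dots> \<le> length (free_reduce (f x))" using * t by simp
    also have "\<dots> \<le> D" using length_free_reduce length_f order_trans by blast
    finally show ?thesis by (intro exI[of _ "v @ [x]"] exI[of _ "[]"]) simp
  qed
qed

text \<open>In \<open>bounded_cancellation\<close>, \<open>D * (D + D)\<close> bounds the segment of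
  the reduced path between the two prefixes, because its image has length at most
  \<open>D + D\<close>. Applying \<open>f\<close> again costs a factor \<open>D\<close>, and the
  last prefix ends within \<open>D\<close> of the cancellation point.\<close>

definition "canc_bound = D + 2 * D ^ 3"

text \<open>The cancelled part \<open>s\<close> is a prefix of the images of both \<open>v\<close> and \<open>u\<inverse>\<close>, so its endpoint is close
  to the image of a prefix of each; the reduced path \<open>u v\<close> passes between these prefixes, and
  applying \<open>g\<close> shows that it does so quickly.\<close>

lemma bounded_cancellation:
  assumes uv: "reduced (u @ v)"
    and s: "free_reduce (ext f u) = p @ s" "free_reduce (ext f v) = inv_word s @ q"
  shows "length s \<le> canc_bound"
proof -
  obtain v1 v2 where v: "v = v1 @ v2" "length (free_reduce (s @ ext f v1)) \<le> D"
    using prefix_near_image[OF s(2)] by auto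
  have "free_reduce (ext f (inv_word u)) = inv_word s @ inv_word p"
    by (simp add: f.ext_inv_word free_reduce_inv_word s(1))
  then obtain u1 u2 where u: "inv_word u = u1 @ u2" "length (free_reduce (s @ ext f u1)) \<le> D"
    using prefix_near_image[of "inv_word u" "inv_word s" "inv_word p"] by auto
  have "u = inv_word u2 @ inv_word u1" using u(1) by (metis inv_word_simps(3,4))
  then have red: "reduced (inv_word u1 @ v1)" using uv v(1) by (simp add: reduced_append) (auto simp: reduced_append)
  have "free_reduce (ext f (inv_word u1 @ v1)) = free_reduce (inv_word (s @ ext f u1) @ s @ ext f v1)"
    by (simp add: f.ext_inv_word free_reduce_simps)
  then have "length (free_reduce (ext f (inv_word u1 @ v1))) \<le> D + D"
    using length_free_reduce_append[of "inv_word (s @ ext f u1)" "s @ ext f v1"] u(2) v(2)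
    by (simp del: inv_word_simps(3))
  then have "D * length (free_reduce (ext f (inv_word u1 @ v1))) \<le> D * (D + D)"
    by (rule mult_le_mono2)
  from order_trans[OF length_le_ext[OF red] this]
  have v1: "length v1 \<le> 2 * D ^ 2" by (simp add: power2_eq_square algebra_simps)
  have "reduced s" by (metis reduced_append reduced_free_reduce s(1))
  then have "length s = length (free_reduce ((s @ ext f v1) @ inv_word (ext f v1)))"
    by (simp add: free_reduce_simps) (simp add: foldr_push_id)
  also have "\<dots> \<le> D + D * length v1"
    by (rule order_trans[OF length_free_reduce_append])
      (use v(2) length_ext_f[of v1] length_free_reduce[of "ext f v1"] in simp)
  also have "\<dots> \<le> D + D * (2 * D ^ 2)" using v1 by (intro add_left_mono mult_le_mono2)
  also have "\<dots> = canc_bound" by (simp add: canc_bound_def power2_eq_square power3_eq_cube)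
  finally show ?thesis .
qed

text \<open>At most \<open>canc_bound\<close> letters at the end of the image of \<open>u\<close>
  can be cancelled, and \<open>q\<close> is longer; so its first letter survives whatever
  \<open>v\<close> is.\<close>

lemma image_prefix:
  assumes "reduced (u @ v)" "free_reduce (ext f u) = s @ q" "canc_bound < length q"
  shows "\<exists>t. free_reduce (ext f (u @ v)) = s @ hd q # t"
proof -
  obtain a b c where *: "free_reduce (ext f u) = a @ b" "free_reduce (ext f v) = inv_word b @ c"
      "free_reduce (free_reduce (ext f u) @ free_reduce (ext f v)) = a @ c"
    using reduced_cancellation[OF reduced_free_reduce reduced_free_reduce] by metis
  have b: "length b \<le> canc_bound" using bounded_cancellation[OF assms(1) *(1,2)] .
  then have "length b \<le> length q" using assms(3) by simp
  then obtain t where t: "q = t @ b" "a = s @ t"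
    using append_eq_appendD_suffix[of s q a b] * assms(2) by auto
  then have "t \<noteq> []" using b assms(3) by auto
  then have "a = s @ hd q # tl t" using t by simp
  then show ?thesis using *(3) by simp
qed

lemma image_suffix:
  assumes "reduced (u @ v)" "free_reduce (ext f v) = p @ s" "canc_bound < length p"
  shows "\<exists>t. free_reduce (ext f (u @ v)) = t @ last p # s"
proof -
  have "reduced (inv_word v @ inv_word u)"
    using assms(1) reduced_inv_word[of "u @ v"] by (simp del: reduced_inv_word)
  moreover have "free_reduce (ext f (inv_word v)) = inv_word s @ inv_word p"
    by (simp add: f.ext_inv_word free_reduce_inv_word assms(2))
  ultimately obtain t where
      "free_reduce (ext f (inv_word v @ inv_word u)) = inv_word s @ hd (inv_word p) # t"
    using image_prefix[of "inv_word v" "inv_word u" "inv_word s" "inv_word p"] assms(3) by auto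
  moreover have "p \<noteq> []" using assms(3) by auto
  moreover have "free_reduce (ext f (u @ v)) = inv_word (free_reduce (ext f (inv_word v @ inv_word u)))"
    by (simp add: f.ext_inv_word free_reduce_inv_word[symmetric])
  ultimately show ?thesis by (auto simp: hd_inv_word)
qed

text \<open>If the axis of \<open>z\<close> in the tree runs through \<open>B1\<close> and \<open>B2\<close>, then the axis of its image runs through
  the branching point \<open>s\<inverse>\<close> of the images of \<open>B1\<inverse>\<close> and \<open>B2\<close>, in directions that do not depend on \<open>z\<close>.\<close>

lemma image_core:
  assumes z: "cyc_reduced z" "z \<noteq> []"
    and per: "\<And>N. n0 \<le> N \<Longrightarrow> \<exists>r. word_power N z = B2 @ r" "\<And>N. n0 \<le> N \<Longrightarrow> \<exists>l. word_power N z = l @ B1"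
    and B: "free_reduce (ext f B1) = p @ s" "free_reduce (ext f B2) = inv_word s @ q"
    and pq: "reduced (p @ q)" "canc_bound < length p" "canc_bound < length q"
  obtains c where "free_reduce (s @ ext f z @ inv_word s) = c" "c \<noteq> []" "cyc_reduced c"
    "hd c = hd q" "last c = last p"
proof -
  \<comment> \<open>Large enough for the power to contain the blocks, and, as
    \<open>length_le_ext\<close> loses a factor \<open>D\<close>, for its image to be longer than
    \<open>2 * length s + 2\<close>, so that the outer copies of \<open>s\<inverse>\<close> and
    \<open>s\<close> do not overlap.\<close>
  define N where "N = Suc (n0 + D * (2 * length s + 2))"
  let ?w = "free_reduce (ext f (word_power N z))"
  have red: "reduced (word_power N z)" using z by (intro reduced_word_power)
  have "n0 \<le> N" by (simp add: N_def)
  then obtain r l where rl: "word_power N z = B2 @ r" "word_power N z = l @ B1"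
    using per by metis
  obtain t where t: "?w = inv_word s @ hd q # t"
    using image_prefix[of B2 r "inv_word s" q] red rl B pq by auto
  obtain t' where t': "?w = t' @ last p # s"
    using image_suffix[of l B1 p s] red B(1) pq(2) unfolding rl(2) by blast
  have "D * (2 * length s + 2) < N" by (simp add: N_def)
  also have "N \<le> length (word_power N z)" using z(2) by (cases z) auto
  also have "\<dots> \<le> D * length ?w" by (rule length_le_ext[OF red])
  finally have len: "2 * length s + 2 < length ?w" unfolding mult_less_cancel1 by blast
  then have "length s \<le> length (hd q # t)" using t by simp
  then obtain w where w: "hd q # t = w @ s" "t' @ [last p] = inv_word s @ w"
    using append_eq_appendD_suffix[of "inv_word s" "hd q # t" "t' @ [last p]" s] t t' by auto
  have "w \<noteq> []" using len t w(1) by (auto dest!: arg_cong[where f = length])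
  then have hl: "hd w = hd q" "last w = last p"
    using arg_cong[OF w(1), of hd] arg_cong[OF w(2), of last] by simp_all
  have wN: "?w = inv_word s @ w @ s" using t w by simp
  then have "reduced w" by (metis reduced_append reduced_free_reduce)
  have pow: "free_reduce (word_power N (s @ ext f z @ inv_word s)) = w"
  proof -
    have "free_reduce (word_power N (s @ ext f z @ inv_word s)) = free_reduce (s @ ?w @ inv_word s)"
      unfolding free_reduce_word_power_conj ext_word_power by (simp add: free_reduce_simps)
    also have "\<dots> = w" unfolding wN using \<open>reduced w\<close>
      by (simp add: free_reduce_simps) (simp add: foldr_push_id)
    finally show ?thesis .
  qed
  let ?g = "free_reduce (s @ ext f z @ inv_word s)"
  obtain h c where hc: "?g = h @ c @ inv_word h" "cyc_reduced c" "?g \<noteq> [] \<Longrightarrow> c \<noteq> []"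
    using reduced_core[OF reduced_free_reduce] by metis
  have pow': "free_reduce (word_power N ?g) = w"
    using free_reduce_word_power_cong[of ?g "s @ ext f z @ inv_word s" N] pow by simp
  then have "?g \<noteq> []" using \<open>w \<noteq> []\<close> by auto
  then have c: "c \<noteq> []" by (rule hc(3))
  have "reduced (h @ c @ inv_word h)" using hc(1) reduced_free_reduce by metis
  then have "reduced (h @ word_power N c @ inv_word h)"
    using hc(2) c by (rule reduced_conj_word_power) (simp add: N_def)
  then have w_eq: "w = h @ word_power N c @ inv_word h"
    using pow'[unfolded hc(1) free_reduce_word_power_conj] by simp
  \<comment> \<open>Otherwise the first and the last letter of \<open>w\<close> would be inverse to
    each other; but these are \<open>hd q\<close> and \<open>last p\<close>, which do not cancel in
    \<open>p @ q\<close>.\<close>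
  have "h = []"
  proof (rule ccontr)
    assume h: "h \<noteq> []"
    then have "hd w = hd h" "last w = inv_letter (hd h)" by (simp_all add: w_eq last_inv_word)
    moreover have "p \<noteq> []" "q \<noteq> []" using pq by auto
    ultimately show False using pq(1) hl by (auto simp: reduced_append)
  qed
  then have "hd c = hd w" using c by (simp add: w_eq N_def)
  moreover from \<open>h = []\<close> have "last c = last w"
    using c by (simp add: w_eq N_def flip: word_power_commute)
  ultimately have "hd c = hd w" "last c = last w" .
  with \<open>h = []\<close> hc c hl show ?thesis by (intro that[of c]) simp_all
qed

end

section \<open>Periodic words and cutting a cyclic word in two\<close>

lemma word_power_periodic_prefix:
  assumes "x @ B = B @ r" "x \<noteq> []" "length B \<le> N"
  shows "\<exists>t. word_power N x = B @ t"
proof -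
  have "\<exists>r. word_power N x @ B = B @ r" for N
    by (induction N) (use assms(1) in \<open>auto, metis append.assoc\<close>)
  moreover have "length B \<le> length (word_power N x)" using assms(2,3) by (cases x) auto
  ultimately show ?thesis by (meson append_eq_appendD_prefix)
qed

lemma word_power_periodic_suffix:
  assumes "B @ x = r @ B" "x \<noteq> []" "length B \<le> N"
  shows "\<exists>t. word_power N x = t @ B"
proof -
  have "\<exists>r. B @ word_power N x = r @ B" for N
  proof (induction N)
    case (Suc N)
    then obtain r' where "B @ word_power N x = r' @ B" by blast
    then have "B @ word_power (Suc N) x = (r @ r') @ B" using assms(1) by simp (metis append.assoc)
    then show ?case by blast
  qed simp
  then obtain r' where "B @ word_power N x = r' @ B" by blast
  moreover have "length B \<le> length (word_power N x)" using assms(2,3) by (cases x) auto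
  ultimately show ?thesis by (meson append_eq_appendD_suffix)
qed

text \<open>On the axes of \<open>x y\<close> and \<open>y x\<close>, the base point has the block \<open>B1\<close> on its left and \<open>B2\<close> on its
  right; \<open>n\<close> only makes the powers long enough to contain the blocks.\<close>

definition same_block :: "nat \<Rightarrow> word \<Rightarrow> word \<Rightarrow> bool" where
  "same_block m x y \<longleftrightarrow> (\<exists>n B1 B2 r1 r2 l1 l2. length B1 = m \<and> length B2 = m \<and>
     word_power n (x @ y) = B2 @ r1 \<and> word_power n (y @ x) = B2 @ r2 \<and>
     word_power n (x @ y) = l1 @ B1 \<and> word_power n (y @ x) = l2 @ B1)"

text \<open>Both \<open>x\<close> and \<open>y\<close> begin with the first letter of
  \<open>B\<close>, so closing up \<open>x\<close> creates the same pair of neighbours that already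
  occurs where \<open>x\<close> meets \<open>y\<close>.\<close>

lemma same_block_cyc_reduced:
  assumes "cyc_reduced (x @ y)" "x \<noteq> []" "y \<noteq> []"
    and "word_power n (x @ y) = B @ r1" "word_power n (y @ x) = B @ r2" "B \<noteq> []"
  shows "cyc_reduced x"
proof -
  have "n \<noteq> 0" using assms(4,6) by (cases n) auto
  then obtain k where "n = Suc k" by (cases n) auto
  then have "hd (word_power n (x @ y)) = hd x" "hd (word_power n (y @ x)) = hd y"
    using assms(2,3) by simp_all
  then have "hd x = hd B" "hd y = hd B" unfolding assms(4,5) using assms(6) by simp_all
  then show ?thesis using assms(1-3) by (auto simp: cyc_reduced_def reduced_append)
qed

text \<open>By \<open>word_power_rotate\<close>, putting \<open>x\<close> in front of a power of
  \<open>y @ x\<close> gives a power of \<open>x @ y\<close> followed by \<open>x\<close>. Both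
  powers begin with \<open>B2\<close>, so \<open>B2\<close> agrees with its own shift by
  \<open>x\<close>, that is, it is a prefix of high powers of \<open>x\<close>; likewise for
  \<open>B1\<close> from the right.\<close>

lemma same_block_periodic:
  assumes "x \<noteq> []"
    and "word_power n (x @ y) = B2 @ r1" "word_power n (y @ x) = B2 @ r2"
    and "word_power n (x @ y) = l1 @ B1" "word_power n (y @ x) = l2 @ B1"
  shows "length B2 \<le> N \<Longrightarrow> \<exists>r. word_power N x = B2 @ r"
    and "length B1 \<le> N \<Longrightarrow> \<exists>l. word_power N x = l @ B1"
proof -
  have "B2 @ r1 @ x = (x @ B2) @ r2"
    using word_power_rotate[of n x y] by (simp add: assms(2,3))
  then obtain t where "x @ B2 = B2 @ t"
    using append_eq_appendD_prefix[of "x @ B2" r2 B2 "r1 @ x"] by auto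
  then show "length B2 \<le> N \<Longrightarrow> \<exists>r. word_power N x = B2 @ r"
    using assms(1) by (rule word_power_periodic_prefix)
  have "l1 @ B1 @ x = (x @ l2) @ B1"
    using word_power_rotate[of n x y] by (simp add: assms(4,5))
  then obtain t where "B1 @ x = t @ B1"
    using append_eq_appendD_suffix[of l1 "B1 @ x" "x @ l2" B1] by auto
  then show "length B1 \<le> N \<Longrightarrow> \<exists>l. word_power N x = l @ B1"
    using assms(1) by (rule word_power_periodic_suffix)
qed

text \<open>One more than \<open>D * (2 * canc_bound)\<close>: the image of a reduced block of this
  length has more than \<open>2 * canc_bound\<close> letters. Cancellation between two blocks
  removes at most \<open>canc_bound\<close> of them, and what is left still exceeds the hypothesis
  of \<open>image_prefix\<close>.\<close>

definition block_bound :: "nat \<Rightarrow> nat" where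
  "block_bound D = Suc (D * (2 * (D + 2 * D ^ 3)))"

text \<open>Conjugating by one and the same \<open>s\<close> turns the images of \<open>x\<close>
  and \<open>y\<close> into cyclically reduced words \<open>c\<close> and \<open>d\<close> that
  share their first and their last letter. Hence nothing cancels in \<open>c @ d\<close>, not even
  cyclically.\<close>

lemma (in aut_pair) conj_length_split:
  assumes xy: "cyc_reduced (x @ y)" "x \<noteq> []" "y \<noteq> []" and "same_block (block_bound D) x y"
  shows "conj_length (ext f (x @ y)) = conj_length (ext f x) + conj_length (ext f y)"
    and "cyc_reduced x" "cyc_reduced y"
proof -
  obtain n B1 B2 r1 r2 l1 l2 where len: "length B1 = block_bound D" "length B2 = block_bound D"
    and w: "word_power n (x @ y) = B2 @ r1" "word_power n (y @ x) = B2 @ r2"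
      "word_power n (x @ y) = l1 @ B1" "word_power n (y @ x) = l2 @ B1"
    using assms(4) unfolding same_block_def by blast
  have "B2 \<noteq> []" using len(2) by (auto simp: block_bound_def)
  then show cyc: "cyc_reduced x" "cyc_reduced y"
    using same_block_cyc_reduced[OF xy w(1,2)] same_block_cyc_reduced[OF _ xy(3,2) w(2,1)] xy(1)
    by (auto simp: cyc_reduced_rotate)
  have "reduced (word_power n (x @ y) @ word_power n (x @ y))"
    using cyc_reduced_word_power[OF xy(1)] by (simp add: cyc_reduced_iff)
  \<comment> \<open>The two blocks meet at the junction of two consecutive copies of the power, the
    left copy ending in \<open>B1\<close> and the right one beginning with
    \<open>B2\<close>.\<close>
  then have "reduced (l1 @ (B1 @ B2) @ r1)" by (subst (asm) (2) w(1), subst (asm) w(3)) simp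
  then have red: "reduced (B1 @ B2)" unfolding reduced_append[of l1] reduced_append[of "B1 @ B2"] by blast
  then have redB: "reduced B1" "reduced B2" by (simp_all add: reduced_append)
  obtain p s q where B: "free_reduce (ext f B1) = p @ s" "free_reduce (ext f B2) = inv_word s @ q"
    and pq: "reduced (p @ q)"
    using reduced_cancellation[OF reduced_free_reduce reduced_free_reduce] by metis
  have s: "length s \<le> canc_bound" by (rule bounded_cancellation[OF red B])
  have "D * (2 * canc_bound) < length B1" by (simp add: len block_bound_def canc_bound_def)
  from order.strict_trans2[OF this length_le_ext[OF redB(1)]] have p: "canc_bound < length p" using s B(1) by simp
  have "D * (2 * canc_bound) < length B2" by (simp add: len block_bound_def canc_bound_def)
  from order.strict_trans2[OF this length_le_ext[OF redB(2)]] have q: "canc_bound < length q" using s B(2) by simp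
  obtain c where c: "free_reduce (s @ ext f x @ inv_word s) = c" "c \<noteq> []" "cyc_reduced c"
      "hd c = hd q" "last c = last p"
    by (rule image_core[OF cyc(1) xy(2) same_block_periodic[OF xy(2) w] B pq p q,
          where ?n0.0 = "block_bound D"]) (auto simp: len)
  obtain d where d: "free_reduce (s @ ext f y @ inv_word s) = d" "d \<noteq> []" "cyc_reduced d"
      "hd d = hd q" "last d = last p"
    by (rule image_core[OF cyc(2) xy(3) same_block_periodic[OF xy(3) w(2,1,4,3)] B pq p q,
          where ?n0.0 = "block_bound D"]) (auto simp: len)
  have "hd q \<noteq> inv_letter (last p)" using pq p q by (auto simp: reduced_append)
  then have cd: "cyc_reduced (c @ d)" using c d by (auto simp: cyc_reduced_def reduced_append)
  have *: "conj_length (ext f z) = conj_length (free_reduce (s @ ext f z @ inv_word s))" for z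
    using conj_length_conj[of s "ext f z"] conj_length_cong[of "free_reduce (s @ ext f z @ inv_word s)"]
    by simp
  have "free_reduce (s @ ext f (x @ y) @ inv_word s)
      = free_reduce ((s @ ext f x @ inv_word s) @ (s @ ext f y @ inv_word s))"
    by (simp add: free_reduce_simps)
  also have "\<dots> = free_reduce (c @ d)" by (rule free_reduce_cong) (use c(1) d(1) in auto)
  also have "\<dots> = c @ d" using cd by (simp add: cyc_reduced_def)
  finally show "conj_length (ext f (x @ y)) = conj_length (ext f x) + conj_length (ext f y)"
    using cd c d *[of x] *[of y] *[of "x @ y"] by simp
qed

section \<open>A rational minimax principle\<close>

lemma Rats_nonneg_coprime:
  assumes "r \<in> \<rat>" "0 \<le> r"
  obtains p q :: nat where "q > 0" "r = real p / real q" "coprime p q"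
  using Rats_abs_nat_div_natE[OF assms(1)] assms(2) by (metis abs_of_nonneg gr0I)

text \<open>Lines strictly above \<open>r\<close> at \<open>t\<close> stay above it nearby by
  continuity, so only the lines that touch \<open>r\<close> need a hypothesis. \<open>P\<close> is
  abstract because both a strict and a weak lower bound are used.\<close>

lemma eventually_affine_greater:
  fixes u v :: "'i \<Rightarrow> real"
  assumes "finite S" "F \<le> at t"
    and "\<And>w. w \<in> S \<Longrightarrow> r \<le> u w + t * v w"
    and "\<And>w. w \<in> S \<Longrightarrow> u w + t * v w = r \<Longrightarrow> eventually (\<lambda>x. P (u w + x * v w)) F"
    and "\<And>y. r < y \<Longrightarrow> P y"
  shows "eventually (\<lambda>x. \<forall>w\<in>S. P (u w + x * v w)) F"
proof (rule eventually_ball_finite[OF assms(1)], rule ballI)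
  fix w assume w: "w \<in> S"
  show "eventually (\<lambda>x. P (u w + x * v w)) F"
  proof (cases "u w + t * v w = r")
    case True
    then show ?thesis using assms(4) w by blast
  next
    case False
    then have "r < u w + t * v w" using assms(3)[OF w] by simp
    moreover have "((\<lambda>x. u w + x * v w) \<longlongrightarrow> u w + t * v w) F"
      by (rule tendsto_mono[OF assms(2)]) (intro tendsto_intros)
    ultimately have "eventually (\<lambda>x. r < u w + x * v w) F" by (intro order_tendstoD)
    then show ?thesis by eventually_elim (rule assms(5))
  qed
qed

text \<open>If no line minimal at \<open>t\<close> had the right sign of slope, moving \<open>t\<close> would increase the
  minimum.\<close>

lemma minimax_real:
  fixes u v :: "'i \<Rightarrow> real"
  assumes S: "finite S" "S \<noteq> {}"
  obtains t r where "0 \<le> t" "t \<le> 1" "\<And>w. w \<in> S \<Longrightarrow> r \<le> u w + t * v w"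
    "\<exists>w\<in>S. u w + t * v w = r"
    "t < 1 \<Longrightarrow> \<exists>w\<in>S. u w + t * v w = r \<and> v w \<le> 0"
    "0 < t \<Longrightarrow> \<exists>w\<in>S. u w + t * v w = r \<and> 0 \<le> v w"
proof -
  define h where "h t = Min ((\<lambda>w. u w + t * v w) ` S)" for t
  have h_le: "h t \<le> u w + t * v w" if "w \<in> S" for w t
    unfolding h_def using S that by (intro Min_le) auto
  have h_in: "\<exists>w\<in>S. u w + t * v w = h t" for t
    using Min_in[of "(\<lambda>w. u w + t * v w) ` S"] S unfolding h_def by fastforce
  have cont: "continuous_on {0..1} h"
    unfolding h_def using S
  proof (induction S rule: finite_ne_induct)
    case (insert w S)
    have "continuous_on {0..1} (\<lambda>t. min (u w + t * v w) (Min ((\<lambda>w. u w + t * v w) ` S)))"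
      by (intro continuous_intros insert.IH)
    then show ?case using insert.hyps by simp
  qed (simp, intro continuous_intros)
  obtain t where t: "0 \<le> t" "t \<le> 1" and max: "\<And>s. 0 \<le> s \<Longrightarrow> s \<le> 1 \<Longrightarrow> h s \<le> h t"
    using continuous_attains_sup[OF compact_Icc _ cont] by auto
  have no: False if "F \<le> at t" "F \<noteq> bot" "eventually (\<lambda>s. 0 \<le> s \<and> s \<le> 1) F"
    and pos: "\<And>w. w \<in> S \<Longrightarrow> u w + t * v w = h t \<Longrightarrow> eventually (\<lambda>x. h t < u w + x * v w) F" for F
  proof -
    have "eventually (\<lambda>x. \<forall>w\<in>S. h t < u w + x * v w) F"
      by (rule eventually_affine_greater[OF S(1) that(1), where r = "h t"]) (use h_le pos in auto)
    then have "eventually (\<lambda>x. False) F" using that(3)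
    proof eventually_elim
      case (elim x)
      obtain w where "w \<in> S" "u w + x * v w = h x" using h_in by blast
      with elim(1) max[of x] elim(2) show ?case by force
    qed
    with that(2) show False by simp
  qed
  show ?thesis
  proof (rule that[OF t, of "h t"])
    show "t < 1 \<Longrightarrow> \<exists>w\<in>S. u w + t * v w = h t \<and> v w \<le> 0"
    proof (rule ccontr)
      assume "t < 1" and neg: "\<not> (\<exists>w\<in>S. u w + t * v w = h t \<and> v w \<le> 0)"
      show False
      proof (rule no[of "at_right t"])
        show "eventually (\<lambda>s. 0 \<le> s \<and> s \<le> 1) (at_right t)"
          using eventually_at_right_less[of t] eventually_at_right_real[OF \<open>t < 1\<close>] 
          by eventually_elim (use t in auto)
        fix w assume w: "w \<in> S" "u w + t * v w = h t"
        then have "v w > 0" using neg by force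
        show "eventually (\<lambda>x. h t < u w + x * v w) (at_right t)"
          using eventually_at_right_less[of t]
          by eventually_elim (use w(2) \<open>v w > 0\<close> in \<open>simp flip: w(2)\<close>)
      qed (auto intro: at_le)
    qed
    show "0 < t \<Longrightarrow> \<exists>w\<in>S. u w + t * v w = h t \<and> 0 \<le> v w"
    proof (rule ccontr)
      assume "0 < t" and pos: "\<not> (\<exists>w\<in>S. u w + t * v w = h t \<and> 0 \<le> v w)"
      have less: "eventually (\<lambda>s. 0 < s \<and> s < t) (at_left t)"
        using eventually_at_left_real[OF \<open>0 < t\<close>] by eventually_elim simp
      show False
      proof (rule no[of "at_left t"])
        show "eventually (\<lambda>s. 0 \<le> s \<and> s \<le> 1) (at_left t)"
          using less by eventually_elim (use t in auto)
        fix w assume w: "w \<in> S" "u w + t * v w = h t"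
        then have "v w < 0" using pos by force
        show "eventually (\<lambda>x. h t < u w + x * v w) (at_left t)"
          using less by eventually_elim (use w(2) \<open>v w < 0\<close> in \<open>simp flip: w(2)\<close>)
      qed (auto intro: at_le)
    qed
  qed (use h_le h_in in auto)
qed

text \<open>At an endpoint of the interval a single line is optimal. At an interior \<open>t\<close>
  two lines of opposite slope pass through the optimum, and a mixture in which the slopes cancel
  makes the two image lengths equal, which exhibits \<open>r\<close> as a quotient of
  integers.\<close>

lemma minimax_rational:
  fixes l A B :: "'i \<Rightarrow> nat"
  assumes S: "finite S" "S \<noteq> {}" and l: "\<And>w. w \<in> S \<Longrightarrow> l w > 0"
  obtains r t :: real and n1 n2 :: nat and w1 w2
  where "r \<in> \<rat>" "0 \<le> r" "t \<in> \<rat>" "0 \<le> t" "t \<le> 1" "0 < n1 + n2" "w1 \<in> S" "w2 \<in> S"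
    "\<And>w. w \<in> S \<Longrightarrow> r * l w \<le> t * A w + (1 - t) * B w"
    "real (n1 * A w1 + n2 * A w2) \<le> r * real (n1 * l w1 + n2 * l w2)"
    "real (n1 * B w1 + n2 * B w2) \<le> r * real (n1 * l w1 + n2 * l w2)"
proof -
  define u v where "u w = real (B w) / l w" and "v w = (real (A w) - B w) / l w" for w
  have uv: "(u w + t * v w) * l w = t * A w + (1 - t) * B w" if "w \<in> S" for w t
    using l[OF that] by (simp add: u_def v_def field_simps)
  obtain t r where t: "0 \<le> t" "t \<le> 1" and r: "\<And>w. w \<in> S \<Longrightarrow> r \<le> u w + t * v w"
    and ex: "\<exists>w\<in>S. u w + t * v w = r"
    and right: "t < 1 \<Longrightarrow> \<exists>w\<in>S. u w + t * v w = r \<and> v w \<le> 0"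
    and left: "0 < t \<Longrightarrow> \<exists>w\<in>S. u w + t * v w = r \<and> 0 \<le> v w"
    using minimax_real[OF S, of u v] by blast
  have r_ge: "r * l w \<le> t * A w + (1 - t) * B w" if "w \<in> S" for w
    using mult_right_mono[OF r[OF that], of "l w"] uv[OF that] by simp
  have r_eq: "r * l w = t * A w + (1 - t) * B w" if "w \<in> S" "u w + t * v w = r" for w
    using uv[OF that(1), of t] that(2) by simp
  have v_sgn: "v w \<le> 0 \<longleftrightarrow> A w \<le> B w" "0 \<le> v w \<longleftrightarrow> B w \<le> A w" if "w \<in> S" for w
    using l[OF that] by (simp_all add: v_def divide_le_0_iff zero_le_divide_iff)
  have "r \<ge> 0"
  proof -
    obtain w where w: "w \<in> S" "u w + t * v w = r" using ex by blast
    have "0 \<le> r * l w" unfolding r_eq[OF w] using t by simp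
    then show ?thesis using l[OF w(1)] by (simp add: zero_le_mult_iff)
  qed
  have "\<exists>n1 n2 w1 w2. w1 \<in> S \<and> w2 \<in> S \<and> 0 < n1 + n2 \<and> r \<in> \<rat>
      \<and> real (n1 * A w1 + n2 * A w2) \<le> r * real (n1 * l w1 + n2 * l w2)
      \<and> real (n1 * B w1 + n2 * B w2) \<le> r * real (n1 * l w1 + n2 * l w2)"
  proof -
    have single: ?thesis if "w \<in> S" "r * l w = A w \<or> r * l w = B w"
      "A w \<le> r * l w" "B w \<le> r * l w" for w
    proof -
      have "r = A w / l w \<or> r = B w / l w" using that(2) l[OF that(1)] by (auto simp: field_simps)
      then have "r \<in> \<rat>" by auto
      with that show ?thesis by (intro exI[of _ 1] exI[of _ 0] exI[of _ w]) simp
    qed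
    consider "t = 0" | "t = 1" | "0 < t" "t < 1" using t by fastforce
    then show ?thesis
    proof cases
      case 1
      then obtain w where w: "w \<in> S" "u w + t * v w = r" "v w \<le> 0" using right by auto
      then show ?thesis using single[OF w(1)] r_eq[OF w(1,2)] v_sgn[OF w(1)] 1 by simp
    next
      case 2
      then obtain w where w: "w \<in> S" "u w + t * v w = r" "0 \<le> v w" using left by auto
      then show ?thesis using single[OF w(1)] r_eq[OF w(1,2)] v_sgn[OF w(1)] 2 by simp
    next
      case 3
      then obtain w1 w2 where w1: "w1 \<in> S" "u w1 + t * v w1 = r" "v w1 \<le> 0"
        and w2: "w2 \<in> S" "u w2 + t * v w2 = r" "0 \<le> v w2" using left right by auto
      have le: "A w1 \<le> B w1" "B w2 \<le> A w2" using w1 w2 v_sgn by auto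
      show ?thesis
      proof (cases "A w1 = B w1")
        case True
        then have "r * l w1 = A w1" using r_eq[OF w1(1,2)] by (simp add: algebra_simps)
        then show ?thesis using single[OF w1(1)] True by simp
      next
        case False
        \<comment> \<open>The weights are crosswise the absolute differences of \<open>A\<close> and
          \<open>B\<close>, so that the mixture has the same total for \<open>A\<close> as for
          \<open>B\<close>.\<close>
        define n1 n2 where "n1 = A w2 - B w2" and "n2 = B w1 - A w1"
        have n: "real n1 = real (A w2) - B w2" "real n2 = real (B w1) - A w1"
          using le by (simp_all add: n1_def n2_def of_nat_diff)
        let ?X = "real (n1 * A w1 + n2 * A w2)" and ?Y = "real (n1 * l w1 + n2 * l w2)"
        have X: "real (n1 * B w1 + n2 * B w2) = ?X" by (simp add: n algebra_simps)
        have "r * ?Y = n1 * (r * l w1) + n2 * (r * l w2)" by (simp add: algebra_simps)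
        also have "\<dots> = t * ?X + (1 - t) * real (n1 * B w1 + n2 * B w2)"
          unfolding r_eq[OF w1(1,2)] r_eq[OF w2(1,2)] by (simp add: algebra_simps)
        also have "\<dots> = ?X" unfolding X by (simp add: algebra_simps)
        finally have rY: "r * ?Y = ?X" .
        have "n2 > 0" using False le by (simp add: n2_def)
        then have "?Y > 0" using l[OF w2(1)] by (simp add: add_nonneg_pos)
        then have "r = ?X / ?Y" using rY by (simp add: field_simps)
        then have "r \<in> \<rat>" by simp
        then show ?thesis
          using w1(1) w2(1) rY X \<open>n2 > 0\<close>
          by (intro exI[of _ n1] exI[of _ n2] exI[of _ w1] exI[of _ w2]) simp
      qed
    qed
  qed
  then obtain n1 n2 w1 w2 where *: "w1 \<in> S" "w2 \<in> S" "0 < n1 + n2" "r \<in> \<rat>"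
      "real (n1 * A w1 + n2 * A w2) \<le> r * real (n1 * l w1 + n2 * l w2)"
      "real (n1 * B w1 + n2 * B w2) \<le> r * real (n1 * l w1 + n2 * l w2)" by metis
  \<comment> \<open>The optimal \<open>t\<close> found above may be irrational. Then every line
    through the optimum is constant, because \<open>r\<close> and the coefficients are rational, and
    a rational number slightly to the right of \<open>t\<close> is optimal too.\<close>
  have "\<exists>s\<in>\<rat>. 0 \<le> s \<and> s \<le> 1 \<and> (\<forall>w\<in>S. r \<le> u w + s * v w)"
  proof (cases "t \<in> \<rat>")
    case True
    then show ?thesis using t r by blast
  next
    case False
    then have t1: "t < 1" using t by (cases "t = 1") auto
    have flat: "v w = 0" if w: "w \<in> S" "u w + t * v w = r" for w
    proof (rule ccontr)
      assume "v w \<noteq> 0"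
      then have "t = (r - u w) / v w" using w(2) by (simp add: field_simps)
      then have "t \<in> \<rat>" using \<open>r \<in> \<rat>\<close> by (simp add: u_def v_def)
      with False show False ..
    qed
    have "eventually (\<lambda>x. \<forall>w\<in>S. r \<le> u w + x * v w) (at_right t)"
    proof (rule eventually_affine_greater[OF S(1), where t = t and r = r])
      fix w assume w: "w \<in> S" "u w + t * v w = r"
      show "eventually (\<lambda>x. r \<le> u w + x * v w) (at_right t)" using flat[OF w] w(2) by simp
    qed (use r in \<open>auto intro: at_le\<close>)
    moreover have "eventually (\<lambda>x. x \<le> 1) (at_right t)"
      using eventually_at_right_real[OF t1] by eventually_elim simp
    ultimately have "eventually (\<lambda>x. x \<le> 1 \<and> (\<forall>w\<in>S. r \<le> u w + x * v w)) (at_right t)"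
      by eventually_elim simp
    then obtain b where b: "b > t" "\<And>x. t < x \<Longrightarrow> x < b \<Longrightarrow> x \<le> 1 \<and> (\<forall>w\<in>S. r \<le> u w + x * v w)"
      unfolding eventually_at_right_field by blast
    obtain s where "s \<in> \<rat>" "t < s" "s < b" using Rats_dense_in_real[OF b(1)] by blast
    then show ?thesis using b(2)[of s] t by (intro bexI[of _ s]) auto
  qed
  then obtain s where s: "s \<in> \<rat>" "0 \<le> s" "s \<le> 1" "\<And>w. w \<in> S \<Longrightarrow> r \<le> u w + s * v w" by blast
  have "r * l w \<le> s * A w + (1 - s) * B w" if "w \<in> S" for w
    using mult_right_mono[OF s(4)[OF that], of "l w"] uv[OF that] by simp
  then show ?thesis using that[OF *(4) \<open>r \<ge> 0\<close> s(1-3) *(3,1,2) _ *(5,6)] by blast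
qed

text \<open>\<open>p / q\<close> is the value, \<open>(a, b)\<close> the optimal weights and \<open>n1, n2, w1, w2\<close> an optimal mixture.\<close>

lemma minimax_nat:
  fixes l A B :: "'i \<Rightarrow> nat"
  assumes S: "finite S" "S \<noteq> {}" and l: "\<And>w. w \<in> S \<Longrightarrow> l w > 0"
  obtains p q a b n1 n2 w1 w2
  where "0 < q" "coprime p q" "0 < a + b" "0 < n1 + n2" "w1 \<in> S" "w2 \<in> S"
    "\<And>w. w \<in> S \<Longrightarrow> p * (a + b) * l w \<le> q * (a * A w + b * B w)"
    "q * (n1 * A w1 + n2 * A w2) \<le> p * (n1 * l w1 + n2 * l w2)"
    "q * (n1 * B w1 + n2 * B w2) \<le> p * (n1 * l w1 + n2 * l w2)"
proof -
  obtain r t :: real and n1 n2 w1 w2 where r: "r \<in> \<rat>" "0 \<le> r" and t: "t \<in> \<rat>" "0 \<le> t" "t \<le> 1"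
    and n: "0 < n1 + n2" "w1 \<in> S" "w2 \<in> S"
    and lower: "\<And>w. w \<in> S \<Longrightarrow> r * l w \<le> t * A w + (1 - t) * B w"
    and upper: "real (n1 * A w1 + n2 * A w2) \<le> r * real (n1 * l w1 + n2 * l w2)"
      "real (n1 * B w1 + n2 * B w2) \<le> r * real (n1 * l w1 + n2 * l w2)"
    using minimax_rational[OF S, of l A B] l by blast
  obtain p q :: nat where pq: "q > 0" "r = p / q" "coprime p q" using Rats_nonneg_coprime[OF r] .
  obtain a c :: nat where ac: "c > 0" "t = a / c" "coprime a c" using Rats_nonneg_coprime[OF t(1,2)] .
  have "a \<le> c" using t(3) ac by simp
  define b where "b = c - a"
  have c: "c = a + b" using \<open>a \<le> c\<close> by (simp add: b_def)
  show ?thesis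
  proof (rule that[OF pq(1,3) _ n])
    show "0 < a + b" using ac(1) c by simp
    fix w assume "w \<in> S"
    have "real c - a = b" by (simp add: c)
    then have "1 - t = real b / c" using ac by (simp add: field_simps)
    then have "real p / q * l w \<le> (a * A w + b * B w) / c"
      using lower[OF \<open>w \<in> S\<close>] pq(2) ac(2) by (simp add: add_divide_distrib)
    then have "real p * c * l w \<le> q * (a * A w + b * B w)"
      using pq(1) ac(1) by (simp add: field_simps)
    then have "real (p * (a + b) * l w) \<le> real (q * (a * A w + b * B w))"
      by (simp add: c algebra_simps)
    then show "p * (a + b) * l w \<le> q * (a * A w + b * B w)" by (simp only: of_nat_le_iff)
  next
    have *: "q * X \<le> p * Y" if "real X \<le> r * real Y" for X Y
    proof -
      have "real (q * X) \<le> real (p * Y)" using that pq by (simp add: field_simps)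
      then show ?thesis by (simp only: of_nat_le_iff)
    qed
    show "q * (n1 * A w1 + n2 * A w2) \<le> p * (n1 * l w1 + n2 * l w2)"
      "q * (n1 * B w1 + n2 * B w2) \<le> p * (n1 * l w1 + n2 * l w2)"
      using upper by (auto intro: *)
  qed
qed

section \<open>Short cyclic words suffice for the lower bound\<close>

lemma rotate_append_ex: "\<exists>u v. w = u @ v \<and> rotate n w = v @ u"
  by (metis append_take_drop_id rotate_drop_take)

lemma cyc_reduced_rotate_iff [simp]: "cyc_reduced (rotate n w) \<longleftrightarrow> cyc_reduced w"
  using rotate_append_ex[of w n] cyc_reduced_rotate by metis

lemma conj_length_ext_rotate [simp]: "conj_length (ext f (rotate n w)) = conj_length (ext f w)"
proof -
  obtain u v where "w = u @ v" "rotate n w = v @ u" using rotate_append_ex by blast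
  then show ?thesis using conj_length_commute[of "ext f u" "ext f v"] by simp
qed

lemma finite_words_length:
  "finite {w \<in> words k. length w = m}" "card {w \<in> words k. length w = m} = (2 * k) ^ m"
proof -
  let ?L = "{..<k} \<times> (UNIV :: bool set)"
  have *: "{w \<in> words k. length w = m} = {w. set w \<subseteq> ?L \<and> length w = m}"
    by (auto simp: words_def)
  have "finite ?L" by simp
  then show "finite {w \<in> words k. length w = m}" "card {w \<in> words k. length w = m} = (2 * k) ^ m"
    unfolding * by (auto simp: finite_lists_length_eq card_lists_length_eq card_cartesian_product)
qed

lemma long_word_same_block:
  assumes "u \<in> words k" "(2 * k) ^ (2 * m) < length u"
  obtains i x y where "rotate i u = x @ y" "x \<noteq> []" "y \<noteq> []" "same_block m x y"
proof -
  let ?A = "{w \<in> words k. length w = m}"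
  \<comment> \<open>Records the \<open>m\<close> letters to the right of position \<open>i\<close>
    and, read backwards, the \<open>m\<close> letters to its left. There are only
    \<open>(2 * k) ^ (2 * m)\<close> such pairs, so two positions agree, and the word is cut
    there.\<close>
  define blk where "blk i = (take m (word_power m (rotate i u)), take m (rev (word_power m (rotate i u))))" for i
  have len: "m \<le> length (word_power m (rotate i u))" for i using assms(2) by (cases u) auto
  have "word_power m (rotate i u) \<in> words k" for i
    using assms(1) by (intro word_power_words) (simp add: words_def)
  then have "blk ` {..<length u} \<subseteq> ?A \<times> ?A"
    using len by (fastforce simp: blk_def words_def dest!: in_set_takeD)
  moreover have "card (?A \<times> ?A) < card {..<length u}"
    using assms(2) by (simp add: card_cartesian_product finite_words_length mult_2 power_add)
  moreover have "finite (?A \<times> ?A)" by (simp add: finite_words_length)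
  ultimately have "\<not> inj_on blk {..<length u}"
    using card_inj_on_le[of blk "{..<length u}" "?A \<times> ?A"] by linarith
  then obtain i0 j0 where ij0: "i0 < length u" "j0 < length u" "blk i0 = blk j0" "i0 \<noteq> j0"
    unfolding inj_on_def by blast
  define i j where "i = min i0 j0" and "j = max i0 j0"
  have ij: "i < j" "j < length u" "blk i = blk j"
    using ij0 by (auto simp: i_def j_def min_def max_def)
  define w where "w = rotate i u"
  define x y where "x = take (j - i) w" and "y = drop (j - i) w"
  have xy: "rotate i u = x @ y" by (simp add: x_def y_def w_def)
  have yx: "rotate j u = y @ x"
  proof -
    have "rotate j u = rotate (j - i) w" using ij(1) by (simp add: w_def rotate_rotate)
    moreover have "j - i < length w" using ij by (simp add: w_def)
    ultimately show ?thesis by (simp add: rotate_drop_take x_def y_def)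
  qed
  have "x \<noteq> []" "y \<noteq> []" using ij by (auto simp: x_def y_def w_def)
  moreover have "same_block m x y"
    unfolding same_block_def
  proof (intro exI conjI)
    let ?p = "word_power m (x @ y)" and ?q = "word_power m (y @ x)"
    show "?p = take m ?p @ drop m ?p" by simp
    show "?q = take m ?p @ drop m ?q"
      using ij(3) unfolding blk_def xy yx by (metis Pair_inject append_take_drop_id)
    have *: "z = rev (drop m (rev z)) @ rev (take m (rev z))" for z :: word
      by (metis append_take_drop_id rev_append rev_rev_ident)
    show "?p = rev (drop m (rev ?p)) @ rev (take m (rev ?p))" by (rule *)
    show "?q = rev (drop m (rev ?q)) @ rev (take m (rev ?p))"
      using ij(3) * unfolding blk_def xy yx by (metis Pair_inject)
    show "length (take m ?p) = m" "length (rev (take m (rev ?p))) = m"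
      using len[of i] unfolding xy by simp_all
  qed
  ultimately show ?thesis using xy that by blast
qed

lemma (in aut_pair) weighted_lower_bound:
  assumes short: "\<And>w. w \<in> words k \<Longrightarrow> cyc_reduced w \<Longrightarrow> length w \<le> (2 * k) ^ (2 * block_bound D) \<Longrightarrow>
      s * length w \<le> a * conj_length (ext f w) + b * conj_length (ext g w)"
    and "w \<in> words k" "cyc_reduced w"
  shows "s * length w \<le> a * conj_length (ext f w) + b * conj_length (ext g w)"
  using assms(2,3)
proof (induction w rule: length_induct)
  case (1 w)
  \<comment> \<open>One cut serves both automorphisms, because \<open>block_bound\<close> depends
    only on their common bound \<open>D\<close>.\<close>
  interpret swap: aut_pair g f D
    by unfold_locales (simp_all add: gf fg length_f length_g)
  show ?case
  proof (cases "length w \<le> (2 * k) ^ (2 * block_bound D)")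
    case True
    then show ?thesis using 1 short by blast
  next
    case False
    then have "(2 * k) ^ (2 * block_bound D) < length w" by simp
    then obtain i x y where i: "rotate i w = x @ y" and xy: "x \<noteq> []" "y \<noteq> []" "same_block (block_bound D) x y"
      using long_word_same_block 1 by metis
    have cyc: "cyc_reduced (x @ y)" using 1 i by (metis cyc_reduced_rotate_iff)
    note f = conj_length_split[OF cyc xy] and g = swap.conj_length_split(1)[OF cyc xy]
    have "x @ y \<in> words k" using 1(2) unfolding i[symmetric] by (simp add: words_def)
    then have wk: "x \<in> words k" "y \<in> words k" by simp_all
    have len: "length w = length x + length y" using arg_cong[OF i, of length] by simp
    then have "length x < length w" "length y < length w" using xy by simp_all
    then have "s * length x + s * length y \<le>
        (a * conj_length (ext f x) + b * conj_length (ext g x)) + (a * conj_length (ext f y) + b * conj_length (ext g y))"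
      using 1(1) wk f(2,3) by (intro add_mono) blast+
    then show ?thesis
      unfolding conj_length_ext_rotate[of f i w, unfolded i f(1), symmetric]
        conj_length_ext_rotate[of g i w, unfolded i g, symmetric]
      by (simp add: len algebra_simps)
  qed
qed

section \<open>Upper bounds from mixtures of two cyclic words\<close>

definition core_words :: "nat \<Rightarrow> word set" where
  "core_words k = {w \<in> words k. cyc_reduced w \<and> w \<noteq> []}"

definition stretch :: "(letter \<Rightarrow> word) \<Rightarrow> (letter \<Rightarrow> word) \<Rightarrow> word \<Rightarrow> real" where
  "stretch f g w = max (real (conj_length (ext f w)) / real (length w)) (real (conj_length (ext g w)) / real (length w))"

lemma bdd_below_stretch: "bdd_below (stretch f g ` W)"
  by (rule bdd_belowI2[of _ 0]) (simp add: stretch_def le_max_iff_disj)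

lemma core_words_nonempty: "k > 0 \<Longrightarrow> core_words k \<noteq> {}"
proof -
  assume "k > 0"
  then have "[(0, True)] \<in> core_words k" by (simp add: core_words_def cyc_reduced_def)
  then show ?thesis by blast
qed

lemma ex_letter_avoiding:
  assumes "k \<ge> 2"
  obtains c :: letter where "fst c < k" "c \<noteq> a" "c \<noteq> b"
proof -
  have "card {(0, True), (0, False), (1, True) :: letter} = 3" by simp
  moreover have "card {a, b} \<le> 2" by (simp add: card_insert_if)
  ultimately have "\<not> {(0, True), (0, False), (1, True)} \<subseteq> {a, b}"
    using card_mono[of "{a, b}" "{(0, True), (0, False), (1, True)}"] by fastforce
  then obtain c where "c \<in> {(0, True), (0, False), (1, True) :: letter}" "c \<noteq> a" "c \<noteq> b" by blast
  then show ?thesis using that[of c] assms by auto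
qed

text \<open>Each connecting letter has two forbidden values, the inverses of its neighbours; in rank
  at least 2 there are at least four letters. The neighbours do not depend on the exponents, so
  neither do \<open>c\<close> and \<open>d\<close>.\<close>

lemma connected_powers:
  assumes "k \<ge> 2" and w1: "w1 \<in> core_words k" and w2: "w2 \<in> core_words k"
  obtains c d where "\<And>m n. m > 0 \<Longrightarrow> n > 0 \<Longrightarrow>
    word_power m w1 @ [c] @ word_power n w2 @ [d] \<in> core_words k"
proof -
  obtain c where c: "fst c < k" "c \<noteq> inv_letter (last w1)" "c \<noteq> inv_letter (hd w2)"
    using ex_letter_avoiding[OF assms(1)] .
  obtain d where d: "fst d < k" "d \<noteq> inv_letter (last w2)" "d \<noteq> inv_letter (hd w1)"
    using ex_letter_avoiding[OF assms(1)] .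
  have hl: "hd (word_power m w) = hd w" "last (word_power m w) = last w" "word_power m w \<noteq> []"
    if mw: "m > 0" "w \<noteq> []" for m w
  proof -
    obtain j where m: "m = Suc j" using mw(1) by (cases m) auto
    show "hd (word_power m w) = hd w" "word_power m w \<noteq> []" using mw(2) by (simp_all add: m)
    show "last (word_power m w) = last w"
      unfolding m word_power_simps word_power_commute[symmetric] using mw(2) by simp
  qed
  have "word_power m w1 @ [c] @ word_power n w2 @ [d] \<in> core_words k" if "m > 0" "n > 0" for m n
  proof -
    have ne: "w1 \<noteq> []" "w2 \<noteq> []" using w1 w2 by (auto simp: core_words_def)
    note h1 = hl[OF that(1) ne(1)] and h2 = hl[OF that(2) ne(2)]
    have "reduced (word_power m w1)" "reduced (word_power n w2)"
      using w1 w2 by (simp_all add: core_words_def reduced_word_power)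
    then have "cyc_reduced (word_power m w1 @ [c] @ word_power n w2 @ [d])"
      using c d h1 h2 reduced_append[of "[c]" "word_power n w2 @ [d]"]
      by (auto simp: cyc_reduced_def reduced_append)
    then show ?thesis
      using w1 w2 c(1) d(1) by (simp add: core_words_def word_power_words)
  qed
  then show ?thesis using that by blast
qed

text \<open>The \<open>+ 1\<close> keeps both exponents positive even if \<open>n1\<close> or
  \<open>n2\<close> is 0, as \<open>connected_powers\<close> requires. All that it and the
  connecting words contribute is absorbed by \<open>K\<close>, which is independent of
  \<open>N\<close>.\<close>

lemma conj_length_connected_powers:
  obtains K where "\<And>N. conj_length (ext f (word_power (n1 * N + 1) w1 @ u @ word_power (n2 * N + 1) w2 @ v))
    \<le> N * (n1 * conj_length (ext f w1) + n2 * conj_length (ext f w2)) + K"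
proof -
  obtain B1 where B1: "\<And>n. length (free_reduce (word_power n (ext f w1))) \<le> n * conj_length (ext f w1) + B1"
    using word_power_length_bounds by metis
  obtain B2 where B2: "\<And>n. length (free_reduce (word_power n (ext f w2))) \<le> n * conj_length (ext f w2) + B2"
    using word_power_length_bounds by metis
  let ?U = "length (free_reduce (ext f u))" and ?V = "length (free_reduce (ext f v))"
  show ?thesis
  proof (rule that)
    fix N
    let ?p = "word_power (n1 * N + 1) (ext f w1)" and ?q = "word_power (n2 * N + 1) (ext f w2)"
    have "conj_length (ext f (word_power (n1 * N + 1) w1 @ u @ word_power (n2 * N + 1) w2 @ v))
        \<le> length (free_reduce (?p @ ext f u @ ?q @ ext f v))"
      using conj_length_le[of "?p @ ext f u @ ?q @ ext f v"] by (simp add: ext_word_power)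
    also have "\<dots> \<le> length (free_reduce ?p) + (?U + (length (free_reduce ?q) + ?V))"
      by (meson add_left_mono length_free_reduce_append order_trans)
    also have "\<dots> \<le> ((n1 * N + 1) * conj_length (ext f w1) + B1) + (?U + (((n2 * N + 1) * conj_length (ext f w2) + B2) + ?V))"
      by (intro add_mono B1 B2 order_refl)
    also have "\<dots> = N * (n1 * conj_length (ext f w1) + n2 * conj_length (ext f w2))
        + (conj_length (ext f w1) + conj_length (ext f w2) + B1 + B2 + ?U + ?V)"
      by (simp add: algebra_simps)
    finally show "conj_length (ext f (word_power (n1 * N + 1) w1 @ u @ word_power (n2 * N + 1) w2 @ v))
        \<le> N * (n1 * conj_length (ext f w1) + n2 * conj_length (ext f w2))
        + (conj_length (ext f w1) + conj_length (ext f w2) + B1 + B2 + ?U + ?V)" .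
  qed
qed

text \<open>The mixture is realised by the words \<open>W N\<close>. Their image lengths exceed
  those of the ideal mixture by at most a constant, which is negligible against a word length of at
  least \<open>N\<close>.\<close>

lemma stretch_upper_bound:
  assumes k: "k \<ge> 2" and w: "w1 \<in> core_words k" "w2 \<in> core_words k" and n: "0 < n1 + n2" and q: "0 < q"
    and f: "q * (n1 * conj_length (ext f w1) + n2 * conj_length (ext f w2)) \<le> p * (n1 * length w1 + n2 * length w2)"
    and g: "q * (n1 * conj_length (ext g w1) + n2 * conj_length (ext g w2)) \<le> p * (n1 * length w1 + n2 * length w2)"
  shows "(INF w\<in>core_words k. stretch f g w) \<le> real p / real q"
proof -
  obtain c d where cd: "\<And>m n. m > 0 \<Longrightarrow> n > 0 \<Longrightarrow>
      word_power m w1 @ [c] @ word_power n w2 @ [d] \<in> core_words k"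
    using connected_powers[OF k w] by metis
  define W where "W N = word_power (n1 * N + 1) w1 @ [c] @ word_power (n2 * N + 1) w2 @ [d]" for N
  define L where "L = n1 * length w1 + n2 * length w2"
  obtain K1 where K1: "\<And>N. conj_length (ext f (W N))
      \<le> N * (n1 * conj_length (ext f w1) + n2 * conj_length (ext f w2)) + K1"
    using conj_length_connected_powers unfolding W_def by metis
  obtain K2 where K2: "\<And>N. conj_length (ext g (W N))
      \<le> N * (n1 * conj_length (ext g w1) + n2 * conj_length (ext g w2)) + K2"
    using conj_length_connected_powers unfolding W_def by metis
  define K where "K = real (max K1 K2)"
  have "L > 0" using n w by (auto simp: L_def core_words_def)
  have len: "N * L \<le> length (W N)" for N by (simp add: W_def L_def algebra_simps)
  have ratio: "real c / length (W N) \<le> p / q + K / N"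
    if "N > 0" "c \<le> N * C + K'" "q * C \<le> p * L" "K' \<le> max K1 K2" for N c C K'
  proof -
    have "N * 1 \<le> N * L" using \<open>L > 0\<close> by (intro mult_le_mono2) simp
    from order_trans[OF this len] have N: "N \<le> length (W N)" by simp
    have "real C \<le> p / q * L"
      using that(3) q by (simp add: field_simps flip: of_nat_mult)
    then have "real N * C \<le> real N * (p / q * L)" by (intro mult_left_mono) simp_all
    also have "\<dots> = p / q * real (N * L)" by simp
    also have "\<dots> \<le> p / q * length (W N)"
      using len[of N] by (intro mult_left_mono) (simp_all only: of_nat_le_iff, simp)
    finally have "real N * C + K \<le> p / q * length (W N) + K" by simp
    moreover have "real c \<le> real N * C + K"
    proof -
      have "real c \<le> real (N * C + K')" using that(2) by (simp only: of_nat_le_iff)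
      then show ?thesis using that(4) by (simp add: K_def)
    qed
    ultimately have "real c / length (W N) \<le> (p / q * length (W N) + K) / length (W N)"
      by (intro divide_right_mono) simp_all
    also have "\<dots> = p / q + K / length (W N)"
      using N that(1) by (cases "W N = []") (simp_all add: add_divide_distrib)
    also have "\<dots> \<le> p / q + K / N"
      using N that(1) by (intro add_left_mono frac_le) (simp_all add: K_def)
    finally show ?thesis .
  qed
  have bound: "(INF w\<in>core_words k. stretch f g w) \<le> p / q + K / N" if "N > 0" for N :: nat
  proof -
    have "(INF w\<in>core_words k. stretch f g w) \<le> stretch f g (W N)"
      by (rule cINF_lower[OF bdd_below_stretch]) (simp only: W_def, rule cd, simp_all)
    also have "\<dots> \<le> p / q + K / N"
      unfolding stretch_def
      using ratio[OF that K1 f[folded L_def]] ratio[OF that K2 g[folded L_def]] by simp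
    finally show ?thesis .
  qed
  have "(\<lambda>N. p / q + K / real (Suc N)) \<longlonglongrightarrow> p / q + 0"
    by (intro tendsto_intros LIMSEQ_Suc lim_const_over_n)
  then have lim: "(\<lambda>N. p / q + K / real (Suc N)) \<longlonglongrightarrow> p / q" by simp
  show ?thesis
    by (rule LIMSEQ_le_const[OF lim]) (intro exI allI impI bound, simp)
qed

text \<open>The larger of the two ratios is at least their mean with weights \<open>a\<close> and
  \<open>b\<close>.\<close>

lemma stretch_lower_bound:
  assumes "k > 0" "0 < q" "0 < a + b"
    and w: "\<And>w. w \<in> core_words k \<Longrightarrow>
      p * (a + b) * length w \<le> q * (a * conj_length (ext f w) + b * conj_length (ext g w))"
  shows "real p / real q \<le> (INF w\<in>core_words k. stretch f g w)"
proof (rule cINF_greatest[OF core_words_nonempty[OF assms(1)]])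
  fix w assume wk: "w \<in> core_words k"
  then have l: "length w > 0" by (simp add: core_words_def)
  let ?m = "stretch f g w" and ?A = "conj_length (ext f w)" and ?B = "conj_length (ext g w)"
  have "real ?A \<le> ?m * length w" "real ?B \<le> ?m * length w"
    using l unfolding stretch_def by (simp_all add: max_mult_distrib_right)
  then have "a * real ?A + b * real ?B \<le> a * (?m * length w) + b * (?m * length w)"
    by (intro add_mono mult_left_mono) simp_all
  then have AB: "real (a * ?A + b * ?B) \<le> (a + b) * (?m * length w)" by (simp add: algebra_simps)
  have "real p * (real (a + b) * length w) = real (p * (a + b) * length w)" by simp
  also have "\<dots> \<le> real (q * (a * ?A + b * ?B))" using w[OF wk] by (simp only: of_nat_le_iff)
  also have "\<dots> = q * real (a * ?A + b * ?B)" by simp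
  also have "\<dots> \<le> q * ((a + b) * (?m * length w))" using AB by (intro mult_left_mono) simp_all
  also have "\<dots> = (q * ?m) * (real (a + b) * length w)" by simp
  finally have "real p \<le> q * ?m"
  proof (rule mult_right_le_imp_le)
    show "0 < real (a + b) * length w" using l assms(3)
      by (intro mult_pos_pos) (simp_all only: of_nat_0_less_iff)
  qed
  then show "real p / real q \<le> ?m" using assms(2) by (simp add: field_simps)
qed

section \<open>Certificates for the value of the infimum\<close>

text \<open>Letters beyond the list \<open>A\<close> of images are fixed.\<close>

definition img :: "word list \<Rightarrow> letter \<Rightarrow> word" where
  "img A x = (case drop (fst x) A of [] \<Rightarrow> [x] | u # _ \<Rightarrow> if snd x then u else inv_word u)"

lemma letter_map_img: "letter_map (img A)"
  by unfold_locales (auto simp: img_def inv_letter_def split: list.split)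

lemma img_nth: "i < length A \<Longrightarrow> img A (i, b) = (if b then A ! i else inv_word (A ! i))"
  by (simp add: img_def Cons_nth_drop_Suc[symmetric])

lemma img_beyond: "length A \<le> fst x \<Longrightarrow> img A x = [x]"
  by (simp add: img_def)

definition letters :: "nat \<Rightarrow> letter list" where
  "letters k = concat (map (\<lambda>i. [(i, True), (i, False)]) [0..<k])"

definition words_upto :: "nat \<Rightarrow> nat \<Rightarrow> word list" where
  "words_upto k = rec_nat [[]] (\<lambda>_ ws. [] # concat (map (\<lambda>w. map (\<lambda>x. x # w) (letters k)) ws))"

lemma set_letters: "set (letters k) = {x. fst x < k}"
  by (auto simp: letters_def)

lemma set_words_upto: "set (words_upto k n) = {w \<in> words k. length w \<le> n}"
proof (induction n)
  case 0
  show ?case by (auto simp: words_upto_def)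
next
  case (Suc n)
  have "set (words_upto k (Suc n)) = insert [] (\<Union>w\<in>set (words_upto k n). (\<lambda>x. x # w) ` set (letters k))"
    by (simp add: words_upto_def)
  also have "\<dots> = {w \<in> words k. length w \<le> Suc n}"
    unfolding Suc set_letters
  proof (rule Set.set_eqI)
    fix w :: word
    show "w \<in> insert [] (\<Union>w\<in>{w \<in> words k. length w \<le> n}. (\<lambda>x. x # w) ` {x. fst x < k})
        \<longleftrightarrow> w \<in> {w \<in> words k. length w \<le> Suc n}"
      by (cases w) auto
  qed
  finally show ?case .
qed

text \<open>The quantifier runs over the entries of a list so that
  \<open>computable_Ball_set\<close> applies.\<close>

definition left_inverse :: "nat \<Rightarrow> word list \<Rightarrow> word list \<Rightarrow> bool" where
  "left_inverse k A B \<longleftrightarrow> length B = k \<and>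
    (\<forall>i\<in>set [0..<k]. free_reduce (ext (img B) (ext (img A) [(i, True)])) = [(i, True)])"

lemma left_inverse_ext:
  assumes "left_inverse k A B" "length A = k"
  shows "free_reduce (ext (img B) (ext (img A) w)) = free_reduce w"
proof -
  interpret A: letter_map "img A" by (rule letter_map_img)
  interpret B: letter_map "img B" by (rule letter_map_img)
  have *: "free_reduce (ext (img B) (img A x)) = [x]" for x
  proof (cases "fst x < k")
    case True
    have pos: "free_reduce (ext (img B) (img A (fst x, True))) = [(fst x, True)]"
      using assms(1) True by (auto simp: left_inverse_def)
    show ?thesis
    proof (cases "snd x")
      case True
      with pos show ?thesis by (metis (full_types) prod.collapse)
    next
      case False
      then have x: "x = inv_letter (fst x, True)" by (simp add: inv_letter_def prod_eq_iff)
      have "free_reduce (ext (img B) (img A (inv_letter (fst x, True)))) = inv_word [(fst x, True)]"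
        unfolding A.map_inv B.ext_inv_word free_reduce_inv_word pos ..
      then show ?thesis unfolding x[symmetric] by (simp flip: x)
    qed
  next
    case False
    then show ?thesis using assms by (simp add: img_beyond left_inverse_def)
  qed
  show ?thesis
  proof (induction w)
    case (Cons x w)
    have "free_reduce (ext (img B) (img A x) @ ext (img B) (ext (img A) w)) = free_reduce ([x] @ w)"
      by (rule free_reduce_cong) (simp_all add: * Cons)
    then show ?case by simp
  qed simp
qed

text \<open>\<open>p / q\<close> is in lowest terms by the Bezout equation for \<open>u\<close> and \<open>v\<close>, and the bound on \<open>length w\<close> is
  that of \<open>weighted_lower_bound\<close>.\<close>

definition certifies ::
  "nat \<Rightarrow> word list \<Rightarrow> word list \<times> word \<times> word \<times> nat \<times> nat \<times> nat \<times> nat \<times> nat \<times> nat \<times> nat \<times> nat \<times> nat \<Rightarrow> bool" where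
  "certifies k A = (\<lambda>(B, w1, w2, D, p, q, a, b, n1, n2, u, v).
     left_inverse k A B \<and> 1 \<le> D \<and> (\<forall>x\<in>set A. length x \<le> D) \<and> (\<forall>x\<in>set B. length x \<le> D) \<and>
     (\<forall>w\<in>set (words_upto k ((2 * k) ^ (2 * block_bound D))). cyc_reduced w \<longrightarrow>
        p * (a + b) * length w \<le> q * (a * conj_length (ext (img A) w) + b * conj_length (ext (img B) w))) \<and>
     0 < q \<and> q * u = p * v + 1 \<and> 0 < a + b \<and> 0 < n1 + n2 \<and> w1 \<in> core_words k \<and> w2 \<in> core_words k \<and>
     q * (n1 * conj_length (ext (img A) w1) + n2 * conj_length (ext (img A) w2)) \<le> p * (n1 * length w1 + n2 * length w2) \<and>
     q * (n1 * conj_length (ext (img B) w1) + n2 * conj_length (ext (img B) w2)) \<le> p * (n1 * length w1 + n2 * length w2))"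

text \<open>The condition \<open>1 \<le> D\<close> takes care of the letters beyond the lists, whose
  images are themselves.\<close>

lemma aut_pair_img:
  assumes "left_inverse k A B" "left_inverse k B A" "1 \<le> D"
    and "\<forall>x\<in>set A. length x \<le> D" "\<forall>x\<in>set B. length x \<le> D"
  shows "aut_pair (img A) (img B) D"
proof -
  have len: "length A = k" "length B = k" using assms(1,2) by (auto simp: left_inverse_def)
  have *: "length (img C x) \<le> D" if "\<forall>x\<in>set C. length x \<le> D" for C x
    using that assms(3) by (auto simp: img_def dest: in_set_dropD split: list.split)
      (metis in_set_dropD list.set_intros(1))+
  interpret A: letter_map "img A" by (rule letter_map_img)
  interpret B: letter_map "img B" by (rule letter_map_img)
  show ?thesis
    by unfold_locales (simp_all add: assms(4,5) * left_inverse_ext[OF assms(1) len(1)]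
        left_inverse_ext[OF assms(2) len(2)])
qed

text \<open>The certificate verifies only one of the two compositions. For the images under an
  automorphism the other one follows by \<open>left_inverse_symmetric\<close>.\<close>

lemma certifies_sound:
  assumes "k \<ge> 2" "certifies k A (B, w1, w2, D, p, q, a, b, n1, n2, u, v)"
    and "left_inverse k B A"
  shows "(INF w\<in>core_words k. stretch (img A) (img B) w) = real p / real q" "0 < q" "coprime p q"
proof -
  note cert = assms(2)[unfolded certifies_def prod.case]
  interpret aut_pair "img A" "img B" D by (rule aut_pair_img) (use cert assms(3) in auto)
  show q: "0 < q" using cert by blast
  show "coprime p q"
  proof (rule coprimeI)
    fix c assume "c dvd p" "c dvd q"
    then have "c dvd p * v" "c dvd q * u" by simp_all
    moreover have "q * u = p * v + 1" using cert by blast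
    ultimately have "c dvd p * v" "c dvd p * v + 1" by simp_all
    then show "is_unit c" using dvd_add_right_iff by blast
  qed
  have "p * (a + b) * length w \<le> q * (a * conj_length (ext (img A) w) + b * conj_length (ext (img B) w))"
    if "w \<in> core_words k" for w
  proof -
    have "p * (a + b) * length w \<le> (q * a) * conj_length (ext (img A) w) + (q * b) * conj_length (ext (img B) w)"
    proof (rule weighted_lower_bound)
      fix w assume "w \<in> words k" "cyc_reduced w" "length w \<le> (2 * k) ^ (2 * block_bound D)"
      then have "p * (a + b) * length w \<le> q * (a * conj_length (ext (img A) w) + b * conj_length (ext (img B) w))"
        using cert set_words_upto by blast
      then show "p * (a + b) * length w \<le> (q * a) * conj_length (ext (img A) w) + (q * b) * conj_length (ext (img B) w)"
        by (simp add: algebra_simps)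
    qed (use that in \<open>auto simp: core_words_def\<close>)
    then show ?thesis by (simp add: algebra_simps)
  qed
  then have "real p / real q \<le> (INF w\<in>core_words k. stretch (img A) (img B) w)"
    by (intro stretch_lower_bound[where a = a and b = b]) (use assms(1) cert in auto)
  moreover have "(INF w\<in>core_words k. stretch (img A) (img B) w) \<le> real p / real q"
    by (rule stretch_upper_bound[OF assms(1), of w1 w2 n1 n2 q]) (use cert in auto)
  ultimately show "(INF w\<in>core_words k. stretch (img A) (img B) w) = real p / real q" by simp
qed

lemma certifies_complete:
  assumes "k \<ge> 2" "left_inverse k A B"
  obtains y where "certifies k A (B, y)"
proof -
  define D where "D = Suc (sum_list (map length (A @ B)))"
  have D: "1 \<le> D" "\<forall>x\<in>set A. length x \<le> D" "\<forall>x\<in>set B. length x \<le> D"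
    using member_le_sum_list[of _ "map length (A @ B)"] by (fastforce simp: D_def intro: le_SucI)+
  define N where "N = (2 * k) ^ (2 * block_bound D)"
  define S where "S = {w \<in> core_words k. length w \<le> N}"
  have fin: "finite S"
    by (rule finite_subset[OF _ finite_set[of "words_upto k N"]])
      (auto simp: S_def core_words_def set_words_upto)
  have "N \<ge> 1" using assms(1) by (simp add: N_def)
  then have "[(0, True)] \<in> S" using assms(1) by (simp add: S_def core_words_def cyc_reduced_def)
  then have ne: "S \<noteq> {}" by blast
  have pos: "length w > 0" if "w \<in> S" for w using that by (simp add: S_def core_words_def)
  obtain p q a b n1 n2 w1 w2 where *: "0 < q" "coprime p q" "0 < a + b" "0 < n1 + n2" "w1 \<in> S" "w2 \<in> S"
    "\<And>w. w \<in> S \<Longrightarrow> p * (a + b) * length w \<le> q * (a * conj_length (ext (img A) w) + b * conj_length (ext (img B) w))"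
    "q * (n1 * conj_length (ext (img A) w1) + n2 * conj_length (ext (img A) w2)) \<le> p * (n1 * length w1 + n2 * length w2)"
    "q * (n1 * conj_length (ext (img B) w1) + n2 * conj_length (ext (img B) w2)) \<le> p * (n1 * length w1 + n2 * length w2)"
    by (rule minimax_nat[OF fin ne, of length "\<lambda>w. conj_length (ext (img A) w)"
        "\<lambda>w. conj_length (ext (img B) w)"]) (rule pos, assumption, rule that)
  obtain u v where uv: "q * u = p * v + 1"
    using bezout_nat[of q p] *(1,2) by (auto simp: coprime_iff_gcd_eq_1 gcd.commute)
  have low: "p * (a + b) * length w \<le> q * (a * conj_length (ext (img A) w) + b * conj_length (ext (img B) w))"
    if "w \<in> set (words_upto k N)" "cyc_reduced w" for w
    using *(7)[of w] that by (cases "w = []") (auto simp: set_words_upto S_def core_words_def)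
  have core: "w1 \<in> core_words k" "w2 \<in> core_words k" using *(5,6) by (simp_all add: S_def)
  have "certifies k A (B, w1, w2, D, p, q, a, b, n1, n2, u, v)"
    unfolding certifies_def prod.case N_def[symmetric]
    by (intro conjI ballI impI low core *(1,3,4,8,9) uv assms(2) D[rule_format])
  then show ?thesis using that by blast
qed

section \<open>Computability of the certificate check\<close>

lemma computable_case_prod [computable_intros]:
  "computable (\<lambda>x. f x (fst (g x)) (snd (g x))) \<Longrightarrow> computable (\<lambda>x. case g x of (a, b) \<Rightarrow> f x a b)"
  by (simp add: case_prod_beta)

lemma computable_Ball_set [computable_intros]:
  "computable (\<lambda>p. s (fst p) (snd p)) \<Longrightarrow> computable l \<Longrightarrow> computable (\<lambda>x. \<forall>y\<in>set (l x). s x y)"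
  using computable_list_all[of s l] by (simp add: list_all_iff)

lemma computable_inv_letter [computable_intros]:
  "computable f \<Longrightarrow> computable (\<lambda>x. inv_letter (f x))"
  unfolding inv_letter_def by (intro computable_intros)

lemma computable_inv_word [computable_intros]:
  assumes "computable f"
  shows "computable (\<lambda>x. inv_word (f x))"
  unfolding inv_word_def by (intro computable_intros assms)

lemma computable_push [computable_intros]:
  assumes "computable f" "computable g"
  shows "computable (\<lambda>x. push (f x) (g x))"
proof -
  have push: "push x w = (case w of [] \<Rightarrow> [x] | y # v \<Rightarrow> if y = inv_letter x then v else x # w)" for x w
    by (cases w) auto
  show ?thesis
    unfolding push
    by (intro computable_intros computable_comp[OF assms(1)] computable_comp[OF assms(2)])
qed

lemma computable_free_reduce [computable_intros]:
  assumes "computable f"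
  shows "computable (\<lambda>x. free_reduce (f x))"
  unfolding free_reduce_def by (intro computable_intros assms)

lemma computable_conj_length [computable_intros]:
  assumes "computable f"
  shows "computable (\<lambda>x. conj_length (f x))"
  unfolding conj_length_def by (intro computable_intros assms)

lemma computable_cyc_reduced [computable_intros]:
  assumes "computable f"
  shows "computable (\<lambda>x. cyc_reduced (f x))"
proof -
  \<comment> \<open>Being a fixed point of reduction replaces the quantifier over positions in
    \<open>reduced\<close>.\<close>
  have "cyc_reduced w \<longleftrightarrow> free_reduce (w @ w) = w @ w" for w
    unfolding cyc_reduced_iff by (metis free_reduce_id reduced_free_reduce)
  moreover have "computable (\<lambda>x. free_reduce (f x @ f x) = f x @ f x)"
    by (intro computable_intros assms)
  ultimately show ?thesis by simp
qed

lemma computable_core_words [computable_intros]: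
  assumes "computable f"
  shows "computable (\<lambda>x. f x \<in> core_words k)"
  unfolding core_words_def words_def mem_Collect_eq by (intro computable_intros assms)

lemma computable_ext_img [computable_intros]:
  assumes "computable A" "computable w"
  shows "computable (\<lambda>x. ext (img (A x)) (w x))"
  unfolding ext_def img_def
  by (intro computable_intros computable_comp[OF assms(1)] computable_comp[OF assms(2)])

lemma computable_words_upto [computable_intros]:
  assumes "computable f"
  shows "computable (\<lambda>x. words_upto k (f x))"
  unfolding words_upto_def by (intro computable_intros assms)

text \<open>The rank \<open>k\<close> is a constant here, so \<open>letters k\<close> and
  \<open>[0..<k]\<close> count as constant lists.\<close>

lemma computable_certifies [computable_intros]:
  assumes "computable f" "computable g"
  shows "computable (\<lambda>x. certifies k (f x) (g x))"
proof -
  have "computable (\<lambda>p. certifies k (fst p) (snd p))"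
    unfolding certifies_def left_inverse_def block_bound_def
    by (intro computable_intros)
  from computable_comp[OF this computable_Pair[OF assms]] show ?thesis by simp
qed

text \<open>Certificates with letters \<open>(i, n)\<close> in place of \<open>(i, 0 < n)\<close>, for which the encoding is onto.\<close>

type_synonym raw_word = "(nat \<times> nat) list"
type_synonym raw_cert = "raw_word list \<times> raw_word \<times> raw_word \<times>
  nat \<times> nat \<times> nat \<times> nat \<times> nat \<times> nat \<times> nat \<times> nat \<times> nat"

definition word_of_raw :: "raw_word \<Rightarrow> word" where
  "word_of_raw r = map (\<lambda>x. (fst x, 0 < snd x)) r"

lemma surj_word_of_raw: "surj word_of_raw"
proof (rule surjI)
  fix w
  have "((\<lambda>x. (fst x, 0 < snd x)) \<circ> (\<lambda>x. (fst x, of_bool (snd x) :: nat))) = (id :: letter \<Rightarrow> letter)"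
    by (simp add: fun_eq_iff)
  then show "word_of_raw (map (\<lambda>x. (fst x, of_bool (snd x))) w) = w"
    unfolding word_of_raw_def by simp
qed

text \<open>The output \<open>h\<close> is a parameter because the same search serves for the value
  \<open>p / q\<close> and for the decision \<open>q < p\<close>.\<close>

lemma search_certificate:
  fixes h :: "nat \<Rightarrow> nat \<Rightarrow> 'c::encodable"
  assumes h: "computable (\<lambda>x. h (fst x) (snd x))"
  shows "\<exists>e. \<forall>A. (\<exists>y. certifies k A y) \<longrightarrow>
    (\<exists>B w1 w2 D p q y. certifies k A (B, w1, w2, D, p, q, y) \<and> reval e [encode A] (encode (h p q)))"
proof -
  define cook :: "raw_cert \<Rightarrow> _" where
    "cook y = (map word_of_raw (fst y), word_of_raw (fst (snd y)), word_of_raw (fst (snd (snd y))), snd (snd (snd y)))" for y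
  define P where "P A y = certifies k A (cook y)" for A y
  define out where "out y = h (fst (snd (snd (snd (snd y))))) (fst (snd (snd (snd (snd (snd y))))))" for y :: raw_cert
  have P: "computable (\<lambda>p. P (fst p) (snd p))"
    unfolding P_def cook_def word_of_raw_def by (intro computable_intros)
  have out: "computable out"
    using computable_comp[OF h computable_Pair,
        of "\<lambda>y :: raw_cert. fst (snd (snd (snd (snd y))))" "\<lambda>y. fst (snd (snd (snd (snd (snd y)))))"]
    unfolding out_def by (simp add: computable_intros)
  have "surj (encode :: raw_cert \<Rightarrow> nat)"
    by (intro surj_encode_prod surj_encode_list surj_encode_nat)
  from computable_search[OF P out this] obtain e where
    e: "\<And>A. \<exists>y. P A y \<Longrightarrow> \<exists>y. P A y \<and> reval e [encode A] (encode (out y))" by blast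
  have "\<exists>B w1 w2 D p q y. certifies k A (B, w1, w2, D, p, q, y) \<and> reval e [encode A] (encode (h p q))"
    if "certifies k A y" for A y
  proof -
    obtain B w1 w2 ns where y: "y = (B, w1, w2, ns)" by (cases y)
    let ?raw = "inv_into UNIV word_of_raw"
    have "cook (map ?raw B, ?raw w1, ?raw w2, ns) = y"
      by (simp add: cook_def y o_def surj_f_inv_f[OF surj_word_of_raw])
    then have "\<exists>y. P A y" using that unfolding P_def by metis
    from e[OF this] obtain z where z: "P A z" "reval e [encode A] (encode (out z))" by blast
    obtain B w1 w2 D p q y where "z = (B, w1, w2, D, p, q, y)" by (metis prod.collapse)
    with z have "certifies k A (map word_of_raw B, word_of_raw w1, word_of_raw w2, D, p, q, y)"
      "reval e [encode A] (encode (h p q))" by (simp_all add: P_def cook_def out_def)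
    then show ?thesis by blast
  qed
  then show ?thesis by blast
qed

section \<open>The action of outer automorphisms on cyclic words\<close>

lemma mult_free_group_eq: "u \<otimes>\<^bsub>free_group k\<^esub> v = free_reduce (u @ v)"
  by (simp add: free_group_def)

lemma inv_free_group: "u \<in> carrier (free_group k) \<Longrightarrow> inv\<^bsub>free_group k\<^esub> u = inv_word u"
  by (rule group.inv_equality[OF group_free_group])
    (auto simp: mult_free_group_eq one_free_group carrier_free_group)

lemma cyc_length_eqI: "C \<noteq> {} \<Longrightarrow> (\<And>u. u \<in> C \<Longrightarrow> length u = n) \<Longrightarrow> cyc_length C = n"
  unfolding cyc_length_def by (rule the_equality) auto

definition rotations :: "word \<Rightarrow> word set" where
  "rotations u = {rotate n u | n. True}"

lemma cyc_length_rotations: "cyc_length (rotations u) = length u"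
  by (rule cyc_length_eqI) (auto simp: rotations_def)

lemma nontrivial_cyclic_words_eq: "nontrivial_cyclic_words k = rotations ` core_words k"
proof -
  have "rotations u = {[]} \<longleftrightarrow> u = []" for u :: word
  proof
    assume *: "rotations u = {[]}"
    have "rotate 0 u \<in> rotations u" unfolding rotations_def by blast
    with * show "u = []" by simp
  qed (auto simp: rotations_def)
  moreover have "cyclic_words k = rotations ` {u \<in> words k. cyc_reduced u}"
    unfolding cyclic_words_def rotations_def by blast
  ultimately show ?thesis
    unfolding nontrivial_cyclic_words_def core_words_def by auto
qed

lemma conj_length_conj_free_group:
  assumes "h \<in> carrier (free_group k)" "g \<in> carrier (free_group k)"
  shows "conj_length (h \<otimes>\<^bsub>free_group k\<^esub> g \<otimes>\<^bsub>free_group k\<^esub> inv\<^bsub>free_group k\<^esub> h) = conj_length g"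
proof -
  have "conj_length (h \<otimes>\<^bsub>free_group k\<^esub> g \<otimes>\<^bsub>free_group k\<^esub> inv\<^bsub>free_group k\<^esub> h)
      = conj_length (h @ g @ inv_word h)"
    by (rule conj_length_cong) (simp add: mult_free_group_eq inv_free_group assms)
  then show ?thesis by (simp add: conj_length_conj)
qed

lemma length_cyclic_word_of:
  assumes "g \<in> carrier (free_group k)" "u \<in> cyclic_word_of k g"
  shows "length u = conj_length g"
  using assms conj_length_conj_free_group conj_length_cyc_reduced
  unfolding cyclic_word_of_def by fastforce

lemma cyclic_word_of_nonempty:
  assumes "g \<in> carrier (free_group k)"
  shows "cyclic_word_of k g \<noteq> {}"
proof -
  have g: "reduced g" "g \<in> words k" using assms by (simp_all add: carrier_free_group)
  obtain h c where hc: "g = h @ c @ inv_word h" "cyc_reduced c"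
    using reduced_core[OF g(1)] by metis
  have "inv_word h \<in> carrier (free_group k)"
    using g by (simp add: carrier_free_group hc(1) reduced_append)
  moreover from this have "inv_word h \<otimes>\<^bsub>free_group k\<^esub> g \<otimes>\<^bsub>free_group k\<^esub> inv\<^bsub>free_group k\<^esub> (inv_word h) = c"
    using hc(2) by (simp add: inv_free_group mult_free_group_eq hc(1) cyc_reduced_def)
      (simp add: free_reduce_simps foldr_push_id)
  ultimately have "c \<in> cyclic_word_of k g" using hc(2) by (auto simp: cyclic_word_of_def)
  then show ?thesis by blast
qed

section \<open>Automorphisms as substitutions\<close>

definition gen_images :: "nat \<Rightarrow> (word \<Rightarrow> word) \<Rightarrow> word list" where
  "gen_images k \<alpha> = map (\<lambda>i. \<alpha> [(i, True)]) [0..<k]"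

lemma length_gen_images [simp]: "length (gen_images k \<alpha>) = k"
  by (simp add: gen_images_def)

lemma hom_eq_ext_img:
  assumes \<alpha>: "\<alpha> \<in> hom (free_group k) (free_group k)" and u: "u \<in> carrier (free_group k)"
  shows "\<alpha> u = free_reduce (ext (img (gen_images k \<alpha>)) u)"
proof -
  interpret \<alpha>: group_hom "free_group k" "free_group k" \<alpha>
    by (intro group_hom.intro group_free_group) (simp add: group_hom_axioms_def \<alpha>)
  let ?f = "img (gen_images k \<alpha>)"
  have letter: "\<alpha> [x] = free_reduce (?f x)" if x: "fst x < k" for x
  proof -
    define y where "y = (fst x, True)"
    have y: "[y] \<in> carrier (free_group k)" "fst y < k" using x by (simp_all add: y_def carrier_free_group)
    have fy: "?f y = \<alpha> [y]" using x by (simp add: y_def img_nth gen_images_def)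
    have \<alpha>y: "\<alpha> [y] \<in> carrier (free_group k)" using y by simp
    show ?thesis
    proof (cases "snd x")
      case True
      then have "x = y" by (simp add: y_def prod_eq_iff)
      then show ?thesis using fy \<alpha>y by (simp add: carrier_free_group)
    next
      case False
      then have x_eq: "x = inv_letter y" by (simp add: y_def inv_letter_def prod_eq_iff)
      have "\<alpha> [x] = \<alpha> (inv\<^bsub>free_group k\<^esub> [y])" using y by (simp add: inv_free_group x_eq)
      also have "\<dots> = inv_word (\<alpha> [y])" by (simp only: \<alpha>.hom_inv[OF y(1)] inv_free_group[OF \<alpha>y])
      also have "\<dots> = ?f x" unfolding x_eq letter_map.map_inv[OF letter_map_img] fy ..
      finally show ?thesis using \<alpha>y fy
        by (simp add: x_eq letter_map.map_inv[OF letter_map_img] carrier_free_group)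
    qed
  qed
  show ?thesis using u
  proof (induction u)
    case Nil
    show ?case using \<alpha>.hom_one by (simp add: one_free_group)
  next
    case (Cons x u)
    then have x: "fst x < k" and u: "u \<in> carrier (free_group k)"
      by (auto simp: carrier_free_group dest: reduced_ConsD)
    have xc: "[x] \<in> carrier (free_group k)" using x by (simp add: carrier_free_group)
    have "x # u = [x] \<otimes>\<^bsub>free_group k\<^esub> u"
      using Cons.prems by (simp add: mult_free_group_eq carrier_free_group)
    then have "\<alpha> (x # u) = \<alpha> [x] \<otimes>\<^bsub>free_group k\<^esub> \<alpha> u" using xc u by simp
    also have "\<dots> = free_reduce (ext ?f (x # u))"
      by (simp add: mult_free_group_eq letter[OF x] Cons.IH[OF u])
    finally show ?case .
  qed
qed

lemma gen_carrier: "i < k \<Longrightarrow> [(i, True)] \<in> carrier (free_group k)"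
  by (simp add: carrier_free_group)

lemma left_inverse_gen_images:
  assumes "\<alpha> \<in> hom (free_group k) (free_group k)" "\<beta> \<in> hom (free_group k) (free_group k)"
    and "\<And>u. u \<in> carrier (free_group k) \<Longrightarrow> \<beta> (\<alpha> u) = u"
  shows "left_inverse k (gen_images k \<alpha>) (gen_images k \<beta>)"
  unfolding left_inverse_def
proof (intro conjI ballI)
  fix i assume "i \<in> set [0..<k]"
  then have i: "[(i, True)] \<in> carrier (free_group k)" by (simp add: gen_carrier)
  then have \<alpha>i: "\<alpha> [(i, True)] \<in> carrier (free_group k)" using assms(1) by (auto simp: hom_def)
  interpret B: letter_map "img (gen_images k \<beta>)" by (rule letter_map_img)
  have "free_reduce (ext (img (gen_images k \<beta>)) (ext (img (gen_images k \<alpha>)) [(i, True)]))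
      = free_reduce (ext (img (gen_images k \<beta>)) (\<alpha> [(i, True)]))"
    by (rule B.ext_cong) (simp add: hom_eq_ext_img[OF assms(1) i])
  also have "\<dots> = [(i, True)]"
    using assms(3)[OF i] hom_eq_ext_img[OF assms(2) \<alpha>i] by simp
  finally show "free_reduce (ext (img (gen_images k \<beta>)) (ext (img (gen_images k \<alpha>)) [(i, True)])) = [(i, True)]" .
qed simp

text \<open>Surjectivity of \<alpha> writes each generator as the image of some \<open>h\<close>;
  \<open>B\<close> returns it to \<open>h\<close>, and the images under \<alpha> lead back to the
  generator.\<close>

lemma left_inverse_symmetric:
  assumes \<alpha>: "\<alpha> \<in> hom (free_group k) (free_group k)" "\<alpha> ` carrier (free_group k) = carrier (free_group k)"
    and B: "left_inverse k (gen_images k \<alpha>) B"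
  shows "left_inverse k B (gen_images k \<alpha>)"
  unfolding left_inverse_def
proof (intro conjI ballI)
  let ?A = "gen_images k \<alpha>"
  interpret A: letter_map "img ?A" by (rule letter_map_img)
  interpret B: letter_map "img B" by (rule letter_map_img)
  fix i assume "i \<in> set [0..<k]"
  then have "[(i, True)] \<in> carrier (free_group k)" by (simp add: gen_carrier)
  then obtain h where h: "h \<in> carrier (free_group k)" "[(i, True)] = \<alpha> h" using \<alpha>(2) by blast
  then have hi: "free_reduce [(i, True)] = free_reduce (ext (img ?A) h)"
    using hom_eq_ext_img[OF \<alpha>(1) h(1)] by simp
  have "free_reduce (ext (img B) [(i, True)]) = free_reduce (ext (img B) (ext (img ?A) h))"
    by (rule B.ext_cong[OF hi])
  also have "\<dots> = free_reduce h" by (rule left_inverse_ext[OF B]) simp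
  finally have "free_reduce (ext (img ?A) (ext (img B) [(i, True)])) = free_reduce (ext (img ?A) h)"
    by (rule A.ext_cong)
  then show "free_reduce (ext (img ?A) (ext (img B) [(i, True)])) = [(i, True)]"
    by (simp only: hi[symmetric] free_reduce_id reduced_single)
qed simp

section \<open>Outer automorphisms as cosets\<close>

lemma auto_free_groupD:
  assumes "\<alpha> \<in> auto G"
  shows "\<alpha> \<in> hom G G" "\<alpha> ` carrier G = carrier G" "x \<in> carrier G \<Longrightarrow> \<alpha> x \<in> carrier G"
  using assms by (auto simp: auto_def Bij_def bij_betw_def hom_def)

lemma AutoGroup_simps:
  "carrier (AutoGroup G) = auto G" "\<alpha> \<in> auto G \<Longrightarrow> \<beta> \<in> auto G \<Longrightarrow> x \<in> carrier G \<Longrightarrow>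
    (\<alpha> \<otimes>\<^bsub>AutoGroup G\<^esub> \<beta>) x = \<alpha> (\<beta> x)"
  by (auto simp: AutoGroup_def BijGroup_def auto_def compose_def)

lemma one_AutoGroup: "x \<in> carrier G \<Longrightarrow> \<one>\<^bsub>AutoGroup G\<^esub> x = x"
  by (simp add: AutoGroup_def BijGroup_def)

lemma ex_left_inverse:
  assumes "\<alpha> \<in> auto (free_group k)"
  obtains B where "left_inverse k (gen_images k \<alpha>) B"
proof -
  interpret A: group "AutoGroup (free_group k)" by (rule group.AutoGroup[OF group_free_group])
  let ?\<beta> = "inv\<^bsub>AutoGroup (free_group k)\<^esub> \<alpha>"
  have \<beta>: "?\<beta> \<in> auto (free_group k)" using assms A.inv_closed[of \<alpha>] by (simp add: AutoGroup_simps)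
  have "?\<beta> (\<alpha> u) = u" if "u \<in> carrier (free_group k)" for u
    using A.l_inv[of \<alpha>] AutoGroup_simps(2)[OF \<beta> assms that] assms that
    by (simp add: AutoGroup_simps(1) one_AutoGroup)
  then show ?thesis
    using that left_inverse_gen_images auto_free_groupD(1) assms \<beta> by blast
qed

lemma inner_autsE:
  assumes "h \<in> inner_auts G"
  obtains g where "g \<in> carrier G" "\<And>x. x \<in> carrier G \<Longrightarrow> h x = g \<otimes>\<^bsub>G\<^esub> x \<otimes>\<^bsub>G\<^esub> inv\<^bsub>G\<^esub> g"
  using assms unfolding inner_auts_def by auto

lemma inner_auts_subset: "inner_auts (free_group k) \<subseteq> auto (free_group k)"
  using normal_imp_subgroup[OF group.normal_inner_auts[OF group_free_group]] subgroup.subset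
  by (fastforce simp: AutoGroup_simps)

text \<open>Representatives of \<phi> agree, and representatives of its inverse invert them, only up
  to inner automorphisms; conjugacy length does not see the difference.\<close>

lemma Out_memD:
  assumes "\<phi> \<in> carrier (Out k)" "\<alpha> \<in> \<phi>"
  shows "\<alpha> \<in> auto (free_group k)"
    and "\<beta> \<in> \<phi> \<Longrightarrow> \<exists>g\<in>carrier (free_group k). \<forall>x\<in>carrier (free_group k).
      \<beta> x = g \<otimes>\<^bsub>free_group k\<^esub> \<alpha> x \<otimes>\<^bsub>free_group k\<^esub> inv\<^bsub>free_group k\<^esub> g"
    and "\<beta> \<in> inv\<^bsub>Out k\<^esub> \<phi> \<Longrightarrow> \<exists>g\<in>carrier (free_group k). \<forall>x\<in>carrier (free_group k).
      \<alpha> (\<beta> x) = g \<otimes>\<^bsub>free_group k\<^esub> x \<otimes>\<^bsub>free_group k\<^esub> inv\<^bsub>free_group k\<^esub> g"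
proof -
  let ?F = "free_group k" and ?G = "AutoGroup (free_group k)" and ?H = "inner_auts (free_group k)"
  interpret F: group ?F by (rule group_free_group)
  interpret A: group ?G by (rule F.AutoGroup)
  interpret H: normal ?H ?G by (rule F.normal_inner_auts)
  interpret O: group "Out k" by (rule group_Out)
  have sub: "\<psi> \<subseteq> auto ?F" if "\<psi> \<in> carrier (Out k)" for \<psi>
    using that H.rcosets_carrier[OF A.group_axioms] by (auto simp: Out_def FactGroup_def AutoGroup_simps)
  show \<alpha>: "\<alpha> \<in> auto ?F" using sub assms by blast
  have "\<phi> \<in> rcosets\<^bsub>?G\<^esub> ?H" using assms(1) by (simp add: Out_def FactGroup_def)
  then have coset: "\<phi> = ?H #>\<^bsub>?G\<^esub> \<alpha>"
    using assms(2) A.repr_independence[OF _ _ H.subgroup_axioms] by (auto simp: RCOSETS_def)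
  show "\<exists>g\<in>carrier ?F. \<forall>x\<in>carrier ?F. \<beta> x = g \<otimes>\<^bsub>?F\<^esub> \<alpha> x \<otimes>\<^bsub>?F\<^esub> inv\<^bsub>?F\<^esub> g" if "\<beta> \<in> \<phi>"
  proof -
    obtain h where h: "h \<in> ?H" "\<beta> = h \<otimes>\<^bsub>?G\<^esub> \<alpha>" using \<open>\<beta> \<in> \<phi>\<close> by (auto simp: coset r_coset_def)
    obtain g where g: "g \<in> carrier ?F" "\<And>x. x \<in> carrier ?F \<Longrightarrow> h x = g \<otimes>\<^bsub>?F\<^esub> x \<otimes>\<^bsub>?F\<^esub> inv\<^bsub>?F\<^esub> g"
      using inner_autsE[OF h(1)] by metis
    have "\<beta> x = h (\<alpha> x)" if "x \<in> carrier ?F" for x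
      unfolding h(2) by (rule AutoGroup_simps(2)[OF subsetD[OF inner_auts_subset h(1)] \<alpha> that])
    then show ?thesis using g auto_free_groupD(3)[OF \<alpha>] by (intro bexI[of _ g]) auto
  qed
  show "\<exists>g\<in>carrier ?F. \<forall>x\<in>carrier ?F. \<alpha> (\<beta> x) = g \<otimes>\<^bsub>?F\<^esub> x \<otimes>\<^bsub>?F\<^esub> inv\<^bsub>?F\<^esub> g" if "\<beta> \<in> inv\<^bsub>Out k\<^esub> \<phi>"
  proof -
    have \<beta>: "\<beta> \<in> auto ?F" using sub O.inv_closed[OF assms(1)] \<open>\<beta> \<in> inv\<^bsub>Out k\<^esub> \<phi>\<close> by blast
    have "\<phi> \<otimes>\<^bsub>Out k\<^esub> inv\<^bsub>Out k\<^esub> \<phi> = ?H" using O.r_inv[OF assms(1)] by (simp add: Out_def FactGroup_def)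
    moreover have "\<alpha> \<otimes>\<^bsub>?G\<^esub> \<beta> \<in> \<phi> \<otimes>\<^bsub>Out k\<^esub> inv\<^bsub>Out k\<^esub> \<phi>"
      using assms(2) \<open>\<beta> \<in> inv\<^bsub>Out k\<^esub> \<phi>\<close> by (auto simp: Out_def FactGroup_def set_mult_def)
    ultimately have "\<alpha> \<otimes>\<^bsub>?G\<^esub> \<beta> \<in> ?H" by simp
    then obtain g where g: "g \<in> carrier ?F" "\<And>x. x \<in> carrier ?F \<Longrightarrow>
        (\<alpha> \<otimes>\<^bsub>?G\<^esub> \<beta>) x = g \<otimes>\<^bsub>?F\<^esub> x \<otimes>\<^bsub>?F\<^esub> inv\<^bsub>?F\<^esub> g"
      using inner_autsE by metis
    then show ?thesis using AutoGroup_simps(2)[OF \<alpha> \<beta>] by (intro bexI[of _ g]) auto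
  qed
qed

lemma Out_nonempty: "\<phi> \<in> carrier (Out k) \<Longrightarrow> \<phi> \<noteq> {}"
proof -
  let ?G = "AutoGroup (free_group k)" and ?H = "inner_auts (free_group k)"
  interpret F: group "free_group k" by (rule group_free_group)
  interpret H: normal ?H ?G by (rule F.normal_inner_auts)
  assume "\<phi> \<in> carrier (Out k)"
  then obtain a where "a \<in> carrier ?G" "\<phi> = ?H #>\<^bsub>?G\<^esub> a" by (auto simp: Out_def FactGroup_def RCOSETS_def)
  then have "a \<in> \<phi>" using H.rcos_self[OF _ H.subgroup_axioms] by blast
  then show ?thesis by blast
qed

text \<open>\<open>out_act\<close> is a union over all representatives of the outer automorphism and
  of the cyclic word, so one common value for all of them is needed before the description in
  \<open>cyc_length\<close> can be evaluated.\<close>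

lemma cyc_length_out_act:
  assumes "\<phi> \<in> carrier (Out k)" "u \<in> core_words k"
    and c: "\<And>\<alpha> n. \<alpha> \<in> \<phi> \<Longrightarrow> conj_length (\<alpha> (rotate n u)) = c"
  shows "cyc_length (out_act k \<phi> (rotations u)) = c"
proof -
  have u: "rotate n u \<in> carrier (free_group k)" for n
  proof -
    have "cyc_reduced (rotate n u)" using assms(2) by (simp add: core_words_def)
    then show ?thesis using assms(2) by (simp add: carrier_free_group core_words_def words_def cyc_reduced_def)
  qed
  have \<alpha>u: "\<alpha> (rotate n u) \<in> carrier (free_group k)" if "\<alpha> \<in> \<phi>" for \<alpha> n
    using auto_free_groupD(3)[OF Out_memD(1)[OF assms(1) that] u] .
  show ?thesis
  proof (rule cyc_length_eqI)
    obtain \<alpha> where \<alpha>: "\<alpha> \<in> \<phi>" using Out_nonempty[OF assms(1)] by blast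
    obtain v where "v \<in> cyclic_word_of k (\<alpha> (rotate 0 u))"
      using cyclic_word_of_nonempty[OF \<alpha>u[OF \<alpha>, of 0]] by blast
    then show "out_act k \<phi> (rotations u) \<noteq> {}"
      using \<alpha> unfolding out_act_def rotations_def by blast
  next
    fix v assume "v \<in> out_act k \<phi> (rotations u)"
    then obtain \<alpha> n where "\<alpha> \<in> \<phi>" "v \<in> cyclic_word_of k (\<alpha> (rotate n u))"
      unfolding out_act_def rotations_def by auto
    then show "length v = c" using length_cyclic_word_of \<alpha>u c by metis
  qed
qed

lemma lambda0_eq_INF_stretch:
  assumes \<phi>: "\<phi> \<in> carrier (Out k)" "\<alpha> \<in> \<phi>" and B: "left_inverse k (gen_images k \<alpha>) B"
  shows "lambda0 k \<phi> = (INF w\<in>core_words k. stretch (img (gen_images k \<alpha>)) (img B) w)"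
proof -
  let ?F = "free_group k" and ?A = "gen_images k \<alpha>"
  interpret O: group "Out k" by (rule group_Out)
  interpret A: letter_map "img ?A" by (rule letter_map_img)
  interpret B: letter_map "img B" by (rule letter_map_img)
  have \<alpha>: "\<alpha> \<in> auto ?F" by (rule Out_memD(1)[OF \<phi>])
  note \<alpha>_hom = auto_free_groupD(1)[OF \<alpha>]
  have rot: "rotate n u \<in> carrier ?F" if "u \<in> core_words k" for u n
  proof -
    have "cyc_reduced (rotate n u)" using that by (simp add: core_words_def)
    then show ?thesis using that by (simp add: carrier_free_group core_words_def words_def cyc_reduced_def)
  qed
  have 1: "cyc_length (out_act k \<phi> (rotations u)) = conj_length (ext (img ?A) u)"
    if u: "u \<in> core_words k" for u
  proof (rule cyc_length_out_act[OF \<phi>(1) u])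
    fix \<beta> n assume \<beta>: "\<beta> \<in> \<phi>"
    obtain g where g: "g \<in> carrier ?F"
        "\<beta> (rotate n u) = g \<otimes>\<^bsub>?F\<^esub> \<alpha> (rotate n u) \<otimes>\<^bsub>?F\<^esub> inv\<^bsub>?F\<^esub> g"
      using Out_memD(2)[OF \<phi> \<beta>] rot[OF u] by blast
    have "conj_length (\<beta> (rotate n u)) = conj_length (\<alpha> (rotate n u))"
      unfolding g(2) by (rule conj_length_conj_free_group[OF g(1) auto_free_groupD(3)[OF \<alpha> rot[OF u]]])
    also have "\<dots> = conj_length (ext (img ?A) (rotate n u))"
      by (rule conj_length_cong) (simp add: hom_eq_ext_img[OF \<alpha>_hom rot[OF u]])
    finally show "conj_length (\<beta> (rotate n u)) = conj_length (ext (img ?A) u)" by simp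
  qed
  have 2: "cyc_length (out_act k (inv\<^bsub>Out k\<^esub> \<phi>) (rotations u)) = conj_length (ext (img B) u)"
    if u: "u \<in> core_words k" for u
  proof (rule cyc_length_out_act[OF O.inv_closed[OF \<phi>(1)] u])
    fix \<beta> n assume \<beta>: "\<beta> \<in> inv\<^bsub>Out k\<^esub> \<phi>"
    let ?u = "rotate n u"
    have \<beta>u: "\<beta> ?u \<in> carrier ?F"
      by (rule auto_free_groupD(3)[OF Out_memD(1)[OF O.inv_closed[OF \<phi>(1)] \<beta>] rot[OF u]])
    obtain g where g: "g \<in> carrier ?F" "\<alpha> (\<beta> ?u) = g \<otimes>\<^bsub>?F\<^esub> ?u \<otimes>\<^bsub>?F\<^esub> inv\<^bsub>?F\<^esub> g"
      using Out_memD(3)[OF \<phi> \<beta>] rot[OF u] by blast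
    \<comment> \<open>\<beta> need not be the inverse of \<alpha>, but \<alpha> \<beta> is inner;
      applying \<open>B\<close> to this equation shows \<beta> \<open>?u\<close> to be a conjugate
      of the image of \<open>?u\<close> under \<open>B\<close>.\<close>
    have eq: "free_reduce (ext (img ?A) (\<beta> ?u)) = free_reduce (g @ ?u @ inv_word g)"
      using g hom_eq_ext_img[OF \<alpha>_hom \<beta>u] by (simp add: mult_free_group_eq inv_free_group)
    have "free_reduce (\<beta> ?u) = free_reduce (ext (img B) (ext (img ?A) (\<beta> ?u)))"
      by (rule left_inverse_ext[OF B, symmetric]) simp
    also have "\<dots> = free_reduce (ext (img B) (g @ ?u @ inv_word g))" by (rule B.ext_cong[OF eq])
    finally have "conj_length (\<beta> ?u) = conj_length (ext (img B) g @ ext (img B) ?u @ inv_word (ext (img B) g))"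
      by (intro conj_length_cong) (simp add: B.ext_inv_word)
    then show "conj_length (\<beta> ?u) = conj_length (ext (img B) u)" by (simp add: conj_length_conj)
  qed
  show ?thesis
    unfolding lambda0_def nontrivial_cyclic_words_eq image_image
    by (rule arg_cong[where f = Inf], rule image_cong[OF refl]) (simp only: 1 2 cyc_length_rotations stretch_def)
qed

lemma strictly_hyperbolic_iff:
  assumes "k > 0"
  shows "strictly_hyperbolic k \<phi> \<longleftrightarrow> lambda0 k \<phi> > 1"
proof -
  define m where "m w = max (real (cyc_length (out_act k \<phi> w))) (real (cyc_length (out_act k (inv\<^bsub>Out k\<^esub> \<phi>) w)))" for w
  let ?W = "nontrivial_cyclic_words k"
  have pos: "cyc_length w > 0" if "w \<in> ?W" for w
    using that by (auto simp: nontrivial_cyclic_words_eq cyc_length_rotations core_words_def)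
  have lambda0: "lambda0 k \<phi> = (INF w\<in>?W. m w / cyc_length w)"
    unfolding lambda0_def m_def by (simp add: max_divide_distrib_right)
  have m_nonneg: "m w \<ge> 0" for w by (simp add: m_def le_max_iff_disj)
  have "?W \<noteq> {}" using core_words_nonempty[OF assms] by (simp add: nontrivial_cyclic_words_eq)
  have bdd: "bdd_below ((\<lambda>w. m w / cyc_length w) ` ?W)"
    by (rule bdd_belowI2[of _ 0]) (simp add: m_nonneg)
  show ?thesis
  proof
    assume "strictly_hyperbolic k \<phi>"
    then obtain c :: real where c: "c > 1" "\<And>w. w \<in> cyclic_words k \<Longrightarrow> c * cyc_length w \<le> m w"
      unfolding strictly_hyperbolic_def m_def by blast
    have "c \<le> lambda0 k \<phi>"
      unfolding lambda0
    proof (rule cINF_greatest[OF \<open>?W \<noteq> {}\<close>])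
      fix w assume "w \<in> ?W"
      then show "c \<le> m w / cyc_length w"
        using c(2)[of w] pos[of w] by (simp add: nontrivial_cyclic_words_def pos_le_divide_eq)
    qed
    with c(1) show "lambda0 k \<phi> > 1" by simp
  next
    assume "lambda0 k \<phi> > 1"
    \<comment> \<open>The infimum itself serves as the constant \<open>c\<close>. The trivial cyclic
      word has no ratio and is treated apart.\<close>
    moreover have "lambda0 k \<phi> * cyc_length w \<le> m w" if "w \<in> cyclic_words k" for w
    proof (cases "w = {[]}")
      case True
      then have "cyc_length w = 0" by (intro cyc_length_eqI) auto
      then show ?thesis by (simp add: m_nonneg)
    next
      case False
      then have w: "w \<in> ?W" using that by (simp add: nontrivial_cyclic_words_def)
      have "lambda0 k \<phi> \<le> m w / cyc_length w" unfolding lambda0 by (rule cINF_lower[OF bdd w])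
      then show ?thesis using pos[OF w] by (simp add: pos_le_divide_eq)
    qed
    ultimately show "strictly_hyperbolic k \<phi>" unfolding strictly_hyperbolic_def m_def by blast
  qed
qed

section \<open>Agreement of the encodings with those of the statement\<close>

lemma aut_encode_eq: "aut_encode k \<alpha> = encode (gen_images k \<alpha>)"
proof -
  have "letter_encode = encode" by (simp add: fun_eq_iff letter_encode_def encode_prod_def)
  then have "word_encode w = encode w" for w by (simp add: word_encode_def encode_list_def)
  then show ?thesis by (simp add: aut_encode_def gen_images_def encode_list_def o_def)
qed

text \<open>\<open>int_encode\<close> sends a nonnegative integer \<open>n\<close> to
  \<open>2 * n\<close>, hence the factors 2. Coprimality is what makes \<open>quotient_of\<close>
  return \<open>p\<close> and \<open>q\<close> unchanged, and is the reason for certifying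
  it.\<close>

lemma rat_encode_nat_quotient:
  assumes "coprime p q" "0 < q"
  shows "rat_encode (of_nat p / of_nat q) = encode (2 * p, 2 * q)"
proof -
  have "of_nat p / of_nat q = Rat.Fract (int p) (int q)" by (simp add: Fract_of_int_quotient)
  moreover have "quotient_of (Rat.Fract (int p) (int q)) = (int p, int q)"
    using assms by (simp add: quotient_of_Fract normalize_stable)
  ultimately show ?thesis
    by (simp add: rat_encode_def encode_prod_def int_encode_def sum_encode_def)
qed

theorem theorem2:
  fixes k :: nat
  assumes "k \<ge> 2"
  shows "(\<forall>\<phi>\<in>carrier (Out k). lambda0 k \<phi> \<in> \<rat>)
    \<and> (\<exists>f. \<forall>\<phi>\<in>carrier (Out k). \<forall>\<alpha>\<in>\<phi>. \<exists>r::rat.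
          lambda0 k \<phi> = of_rat r \<and> reval f [aut_encode k \<alpha>] (rat_encode r))
    \<and> (\<forall>\<phi>\<in>carrier (Out k). strictly_hyperbolic k \<phi> \<longleftrightarrow> lambda0 k \<phi> > 1)
    \<and> (\<exists>f. \<forall>\<phi>\<in>carrier (Out k). \<forall>\<alpha>\<in>\<phi>.
          reval f [aut_encode k \<alpha>] (if strictly_hyperbolic k \<phi> then 1 else 0))"
proof -
  have ex_cert: "\<exists>y. certifies k (gen_images k \<alpha>) y" if "\<phi> \<in> carrier (Out k)" "\<alpha> \<in> \<phi>" for \<phi> \<alpha>
    using ex_left_inverse[OF Out_memD(1)[OF that]] certifies_complete[OF assms] by metis
  have sound: "lambda0 k \<phi> = p / q \<and> 0 < q \<and> coprime p q"
    if "\<phi> \<in> carrier (Out k)" "\<alpha> \<in> \<phi>" "certifies k (gen_images k \<alpha>) (B, w1, w2, D, p, q, y)"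
    for \<phi> \<alpha> B w1 w2 D p q y
  proof -
    obtain a b n1 n2 u v where y: "y = (a, b, n1, n2, u, v)" by (cases y)
    have B: "left_inverse k (gen_images k \<alpha>) B" using that(3) by (auto simp: certifies_def split: prod.splits)
    note \<alpha> = auto_free_groupD[OF Out_memD(1)[OF that(1,2)]]
    show ?thesis
      using certifies_sound[OF assms that(3)[unfolded y] left_inverse_symmetric[OF \<alpha>(1,2) B]]
        lambda0_eq_INF_stretch[OF that(1,2) B] by simp
  qed
  have "computable (\<lambda>x :: nat \<times> nat. (2 * fst x, 2 * snd x))"
    by (intro computable_intros)
  from search_certificate[of "\<lambda>p q. (2 * p, 2 * q)" k, OF this]
  obtain e where e: "\<And>A. \<exists>y. certifies k A y \<Longrightarrow> \<exists>B w1 w2 D p q y.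
      certifies k A (B, w1, w2, D, p, q, y) \<and> reval e [encode A] (encode (2 * p, 2 * q))"
    by blast
  have "computable (\<lambda>x :: nat \<times> nat. snd x < fst x)"
    by (intro computable_intros)
  from search_certificate[of "\<lambda>p q. q < p" k, OF this]
  obtain d where d: "\<And>A. \<exists>y. certifies k A y \<Longrightarrow> \<exists>B w1 w2 D p q y.
      certifies k A (B, w1, w2, D, p, q, y) \<and> reval d [encode A] (encode (q < p))"
    by blast
  have comp: "\<exists>r::rat. lambda0 k \<phi> = of_rat r \<and> reval e [aut_encode k \<alpha>] (rat_encode r)"
    if mem: "\<phi> \<in> carrier (Out k)" "\<alpha> \<in> \<phi>" for \<phi> \<alpha>
  proof -
    obtain B w1 w2 D p q y where c: "certifies k (gen_images k \<alpha>) (B, w1, w2, D, p, q, y)"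
        "reval e [encode (gen_images k \<alpha>)] (encode (2 * p, 2 * q))"
      using e[OF ex_cert[OF mem]] by blast
    note s = sound[OF mem c(1)]
    show ?thesis
      using s c(2) rat_encode_nat_quotient[of p q]
      by (intro exI[of _ "of_nat p / of_nat q"]) (simp add: aut_encode_eq of_rat_divide)
  qed
  have hyp: "strictly_hyperbolic k \<phi> \<longleftrightarrow> lambda0 k \<phi> > 1" for \<phi>
    by (rule strictly_hyperbolic_iff) (use assms in simp)
  have dec: "reval d [aut_encode k \<alpha>] (if strictly_hyperbolic k \<phi> then 1 else 0)"
    if mem: "\<phi> \<in> carrier (Out k)" "\<alpha> \<in> \<phi>" for \<phi> \<alpha>
  proof -
    obtain B w1 w2 D p q y where c: "certifies k (gen_images k \<alpha>) (B, w1, w2, D, p, q, y)"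
        "reval d [encode (gen_images k \<alpha>)] (encode (q < p))"
      using d[OF ex_cert[OF mem]] by blast
    have "strictly_hyperbolic k \<phi> \<longleftrightarrow> q < p" using sound[OF mem c(1)] by (simp add: hyp)
    then show ?thesis using c(2) by (simp add: aut_encode_eq of_bool_def)
  qed
  have "lambda0 k \<phi> \<in> \<rat>" if "\<phi> \<in> carrier (Out k)" for \<phi>
  proof -
    have "\<phi> \<noteq> {}" by (rule Out_nonempty[OF that])
    then obtain \<alpha> where "\<alpha> \<in> \<phi>" by blast
    from comp[OF that this] show ?thesis by auto
  qed
  then show ?thesis using comp hyp dec by blast
qed

end
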